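(* Let $V$ satisfy $(V)$ and $\eta$ satisfy $(\eta)$ (as stated in the context). Fix $\rho_o\in(L^1\cap L^\infty\cap BV)(\mathbb R^n;\mathbb R^m)$. Assume moreover that for fixed $r,\ell\in\mathbb R$ with $\ell>r>0$ and for $x_1,\dots,x_k\in\mathbb R^n$: (1) $\operatorname{spt}\nabla\eta\subseteq B(0,\ell)\setminus B(0,r)$; (2) $\operatorname{spt}\rho_o\subseteq\bigcup_{h=1}^kB(x_h,r/2)$ with $\|x_h-x_j\|>r+\ell$ for all $h,j\in\{1,\dots,k\}$ with $h\ne j$. Then the solution to $\partial_t \rho_i + \nabla\cdot(\rho_i V_i(\nabla\rho*\eta))=0$, $i\in\{1,\dots,m\}$, with initial datum $\rho_o$ at time $0$ is stationary: $\mathcal G_t\rho_o=\rho_o$ for all $t\ge0$.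
   Context: $n,m\ge1$ are integers and $\mathbb R_+=[0,+\infty[$. All spaces $\mathbb R^n$, $\mathbb R^{n\times m}$ carry the Euclidean norm. $B(x,r)$ is the open ball in $\mathbb R^n$ centered at $x$ with radius $r$. $\|u\|_{W^{1,\infty}}=\|u\|_{L^\infty}+\|Du\|_{L^\infty}$. $BV$ is the set of $L^1_{loc}$ functions whose distributional derivative is a Radon measure with finite total variation. $\nabla$ is the differential operator in the space variable $x$; $DV$ is the total derivative of $V$. The support $\operatorname{spt}\rho$ of an $L^1$ function is the complement of the union of all open sets on which $\rho=0$ a.e. Assumption $(\eta)$: $\eta\in (C^3\cap W^{3,1}\cap W^{3,\infty})(\mathbb R^n;\mathbb R)$. Assumption $(V)$: $V\in C^2(\mathbb R^{n\times m};\mathbb R^{n\times m})$, $V(0)=0$ and $\|DV\|_{W^{1,\infty}(\mathbb R^{n\times m};\mathbb R^{(n\times m)^2})}\le L_V$ for an $L_V\in\mathbb R_+$. Write $V=[V_1\cdots V_m]$ with columns $V_i\in\mathbb R^n$. For $\rho=(\rho_1,\dots,\rho_m)$, $\nabla\rho*\eta$ is the $n\times m$ matrix with entries $(\nabla\rho*\eta)_{ji}=\partial_{x_j}(\rho_i*\eta)$, where $(\rho_i(t)*\eta)(x)=\int_{\mathbb R^n}\rho_i(t,\xi)\,\eta(x-\xi)\,d\xi$. Solution: for a non trivial real interval $I$, $\rho\in C^0(I;L^1(\mathbb R^n;\mathbb R^m))$ is a solution to the system on $I$ if, setting $v_i(t,x)=V_i\big((\nabla\rho*\eta)(t,x)\big)$,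 each $\rho_i$ is a solution on $I$ of the linear equation $\partial_t\rho_i+\nabla\cdot(\rho_i\,v_i(t,x))=0$, meaning the Lagrangian one: with datum $\rho_{o,i}$ at time $0\in I$, $$\rho_i(t,x)=\rho_{o,i}\big(X_i(0;t,x)\big)\exp\Big(-\int_0^t(\nabla\cdot v_i)\big(\tau,X_i(\tau;t,x)\big)\,d\tau\Big),$$ where $t\mapsto X_i(t;t_o,x_o)$ solves $\dot x=v_i(t,x)$, $x(t_o)=x_o$ (it coincides with the distributional and with the Kružkov entropy solution). Under $(\eta)$ and $(V)$, for every $\rho_o\in(L^1\cap L^\infty\cap BV)(\mathbb R^n;\mathbb R^m)$ there is a unique global solution on $\mathbb R$ with datum $\rho_o$ at time $0$; it is denoted $t\mapsto\mathcal G_t\rho_o$. *)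

theory Defs
  imports "HOL-Probability.Essential_Supremum"
begin

text \<open>Conventions: \<open>\<real>\<^sup>n\<close> is \<open>real^'n\<close>; an \<open>n \<times> m\<close> matrix is an element of \<open>real^'m^'n\<close> (first index: row),
  whose \<open>norm\<close> is the Euclidean one. Elements of Lebesgue spaces are represented by functions,
  and equality in such spaces is equality almost everywhere.\<close>

definition dpart :: "'a::euclidean_space \<Rightarrow> ('a \<Rightarrow> 'b::real_normed_vector) \<Rightarrow> 'a \<Rightarrow> 'b" where
  "dpart b f x = frechet_derivative f (at x) b"

primrec C_k :: "nat \<Rightarrow> ('a::euclidean_space \<Rightarrow> 'b::real_normed_vector) \<Rightarrow> bool" where
  "C_k 0 f \<longleftrightarrow> continuous_on UNIV f"
| "C_k (Suc k) f \<longleftrightarrow> (\<forall>x. f differentiable (at x)) \<and> (\<forall>b\<in>Basis. C_k k (dpart b f))"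

definition grad :: "(real^'n \<Rightarrow> real) \<Rightarrow> real^'n \<Rightarrow> real^'n" where
  "grad f x = (\<chi> j. dpart (axis j 1) f x)"

definition divergence :: "(real^'n \<Rightarrow> real^'n) \<Rightarrow> real^'n \<Rightarrow> real" where
  "divergence u x = (\<Sum>j\<in>UNIV. dpart (axis j 1) u x $ j)"

text \<open>Total derivative of a map of a matrix variable, as the array of its partial derivatives; for
  \<open>V :: real^'m^'n \<Rightarrow> real^'m^'n\<close> it takes values in \<open>real^'m^'n^'m^'n\<close>, i.e. in
  \<open>\<real>\<close> to the power \<open>(n \<times> m)\<^sup>2\<close> with its Euclidean norm.\<close>

definition matD :: "(real^'m^'n \<Rightarrow> 'b::real_normed_vector) \<Rightarrow> real^'m^'n \<Rightarrow> 'b^'m^'n" where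
  "matD f A = (\<chi> j i. dpart (axis j (axis i 1)) f A)"

definition Linf_norm :: "('a::euclidean_space \<Rightarrow> 'b::real_normed_vector) \<Rightarrow> ereal" where
  "Linf_norm f = esssup lebesgue (\<lambda>x. ereal (norm (f x)))"

definition L_inf :: "('a::euclidean_space \<Rightarrow> 'b::real_normed_vector) \<Rightarrow> bool" where
  "L_inf f \<longleftrightarrow> f \<in> borel_measurable lebesgue \<and> Linf_norm f < \<infinity>"

text \<open>Only used for \<open>u\<close> of class \<open>C\<^sup>1\<close>, so that \<open>Du\<close> is the classical derivative.\<close>

definition W1inf_norm :: "(real^'m^'n \<Rightarrow> 'b::real_normed_vector) \<Rightarrow> ereal" where
  "W1inf_norm u = Linf_norm u + Linf_norm (matD u)"

definition L1_loc :: "(real^'n \<Rightarrow> real) \<Rightarrow> bool" where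
  "L1_loc f \<longleftrightarrow> (\<forall>K. compact K \<longrightarrow> f absolutely_integrable_on K)"

definition test_fun :: "(real^'n \<Rightarrow> real) \<Rightarrow> bool" where
  "test_fun \<phi> \<longleftrightarrow> (\<forall>k. C_k k \<phi>) \<and> compact (closure (support_on UNIV \<phi>))"

definition weak_partial :: "'n \<Rightarrow> (real^'n \<Rightarrow> real) \<Rightarrow> (real^'n \<Rightarrow> real) \<Rightarrow> bool" where
  "weak_partial j f g \<longleftrightarrow> L1_loc f \<and> L1_loc g \<and>
     (\<forall>\<phi>. test_fun \<phi> \<longrightarrow>
        (LINT x|lebesgue. f x * dpart (axis j 1) \<phi> x) = - (LINT x|lebesgue. g x * \<phi> x))"

text \<open>The Sobolev space \<open>W\<^sup>k\<^sup>,\<^sup>p\<close>, where the predicate \<open>Lp\<close> is membership in \<open>L\<^sup>p\<close>.\<close>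

primrec sobolev :: "((real^'n \<Rightarrow> real) \<Rightarrow> bool) \<Rightarrow> nat \<Rightarrow> (real^'n \<Rightarrow> real) \<Rightarrow> bool" where
  "sobolev Lp 0 f \<longleftrightarrow> Lp f"
| "sobolev Lp (Suc k) f \<longleftrightarrow> Lp f \<and> (\<forall>j. \<exists>g. weak_partial j f g \<and> sobolev Lp k g)"

text \<open>A real Radon measure with finite total variation is a difference \<open>\<mu> - \<nu>\<close> of two finite
  (positive) Borel measures; finite Borel measures on \<open>\<real>\<^sup>n\<close> are automatically Radon.\<close>

definition BV :: "(real^'n \<Rightarrow> real) \<Rightarrow> bool" where
  "BV f \<longleftrightarrow> L1_loc f \<and>
     (\<forall>j. \<exists>\<mu> \<nu>. finite_measure \<mu> \<and> finite_measure \<nu> \<and> sets \<mu> = sets borel \<and> sets \<nu> = sets borel \<and>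
        (\<forall>\<phi>. test_fun \<phi> \<longrightarrow>
           (LINT x|lebesgue. f x * dpart (axis j 1) \<phi> x) = - ((LINT x|\<mu>. \<phi> x) - (LINT x|\<nu>. \<phi> x))))"

definition spt :: "('a::euclidean_space \<Rightarrow> 'b::zero) \<Rightarrow> 'a set" where
  "spt f = - \<Union>{U. open U \<and> (AE x in lebesgue. x \<in> U \<longrightarrow> f x = 0)}"

definition eta_assm :: "(real^'n \<Rightarrow> real) \<Rightarrow> bool" where
  "eta_assm \<eta> \<longleftrightarrow> C_k 3 \<eta> \<and> sobolev (integrable lebesgue) 3 \<eta> \<and> sobolev L_inf 3 \<eta>"

definition V_assm :: "(real^'m^'n \<Rightarrow> real^'m^'n) \<Rightarrow> bool" where
  "V_assm V \<longleftrightarrow> C_k 2 V \<and> V 0 = 0 \<and> (\<exists>L\<ge>0. W1inf_norm (matD V) \<le> ereal L)"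

definition conv :: "(real^'n \<Rightarrow> real) \<Rightarrow> (real^'n \<Rightarrow> real) \<Rightarrow> real^'n \<Rightarrow> real" where
  "conv f g x = (LINT \<xi>|lebesgue. f \<xi> * g (x - \<xi>))"

definition grad_conv :: "(real^'n \<Rightarrow> real^'m) \<Rightarrow> (real^'n \<Rightarrow> real) \<Rightarrow> real^'n \<Rightarrow> real^'m^'n" where
  "grad_conv \<rho> \<eta> x = (\<chi> j i. dpart (axis j 1) (conv (\<lambda>\<xi>. \<rho> \<xi> $ i) \<eta>) x)"

definition velocity ::
  "(real^'m^'n \<Rightarrow> real^'m^'n) \<Rightarrow> (real^'n \<Rightarrow> real) \<Rightarrow> (real \<Rightarrow> real^'n \<Rightarrow> real^'m)
     \<Rightarrow> 'm \<Rightarrow> real \<Rightarrow> real^'n \<Rightarrow> real^'n" where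
  "velocity V \<eta> \<rho> i t x = column i (V (grad_conv (\<rho> t) \<eta> x))"

text \<open>\<open>X t t0 x0\<close> is the value at time \<open>t\<close> of the characteristic through \<open>x0\<close> at time \<open>t0\<close>.\<close>

definition is_flow ::
  "real set \<Rightarrow> (real \<Rightarrow> real^'n \<Rightarrow> real^'n) \<Rightarrow> (real \<Rightarrow> real \<Rightarrow> real^'n \<Rightarrow> real^'n) \<Rightarrow> bool" where
  "is_flow I v X \<longleftrightarrow>
     (\<forall>t0\<in>I. \<forall>x0. X t0 t0 x0 = x0 \<and>
        (\<forall>t\<in>I. ((\<lambda>s. X s t0 x0) has_vector_derivative v t (X t t0 x0)) (at t within I)))"

text \<open>The time integral below is the oriented one, so \<open>t < 0\<close> is allowed.\<close>

definition lagrangian_solution ::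
  "real set \<Rightarrow> (real \<Rightarrow> real^'n \<Rightarrow> real^'n) \<Rightarrow> (real^'n \<Rightarrow> real) \<Rightarrow> (real \<Rightarrow> real^'n \<Rightarrow> real) \<Rightarrow> bool" where
  "lagrangian_solution I v u\<^sub>o u \<longleftrightarrow>
     (\<exists>X. is_flow I v X \<and>
        (\<forall>t\<in>I. AE x in lebesgue.
           u t x = u\<^sub>o (X 0 t x) * exp (- (LBINT \<tau>=ereal 0..ereal t. divergence (v \<tau>) (X \<tau> t x)))))"

definition C0_L1 :: "real set \<Rightarrow> (real \<Rightarrow> real^'n \<Rightarrow> real^'m) \<Rightarrow> bool" where
  "C0_L1 I \<rho> \<longleftrightarrow>
     (\<forall>t\<in>I. integrable lebesgue (\<rho> t) \<and>
        ((\<lambda>s. LINT x|lebesgue. norm (\<rho> s x - \<rho> t x)) \<longlongrightarrow> 0) (at t within I))"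

definition nonlocal_solution ::
  "(real^'m^'n \<Rightarrow> real^'m^'n) \<Rightarrow> (real^'n \<Rightarrow> real) \<Rightarrow> real set \<Rightarrow> (real^'n \<Rightarrow> real^'m)
     \<Rightarrow> (real \<Rightarrow> real^'n \<Rightarrow> real^'m) \<Rightarrow> bool" where
  "nonlocal_solution V \<eta> I \<rho>\<^sub>o \<rho> \<longleftrightarrow>
     is_interval I \<and> (\<exists>s\<in>I. \<exists>t\<in>I. s < t) \<and> 0 \<in> I \<and> C0_L1 I \<rho> \<and>
     (\<forall>i. lagrangian_solution I (velocity V \<eta> \<rho> i) (\<lambda>x. \<rho>\<^sub>o x $ i) (\<lambda>t x. \<rho> t x $ i))"

text \<open>The global solution is unique up to null sets; a representative of it is chosen here.\<close>

definition sol_op ::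
  "(real^'m^'n \<Rightarrow> real^'m^'n) \<Rightarrow> (real^'n \<Rightarrow> real) \<Rightarrow> real \<Rightarrow> (real^'n \<Rightarrow> real^'m) \<Rightarrow> real^'n \<Rightarrow> real^'m" where
  "sol_op V \<eta> t \<rho>\<^sub>o = (SOME \<rho>. nonlocal_solution V \<eta> UNIV \<rho>\<^sub>o \<rho>) t"

end

theory Submission
  imports Defs
begin

text \<open>Let \<open>U\<close> be the union of the balls \<open>ball (x h) (r / 2)\<close>. Two points of \<open>U\<close> in the same ball are
closer than \<open>r\<close>, and two points in different balls are further apart than \<open>(r + l) - r = l\<close>. In
both cases \<open>\<nabla>\<eta>\<close> vanishes at their difference. Hence a density carried by \<open>U\<close> has
\<open>\<nabla>\<rho> * \<eta> = 0\<close> on \<open>U\<close> (lemma \<open>grad_conv_vanishes\<close>), and since \<open>V 0 = 0\<close> all velocities vanish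
there: the mass sits where nothing moves.

The constant density \<open>\<rho>\<^sub>o\<close> is therefore a solution (\<open>constant_is_solution\<close>). Its velocity field is
a time-independent Lipschitz field, so it has a global flow, and this flow fixes \<open>U\<close> pointwise
(\<open>transport_of_resting_density\<close>). Outside \<open>U\<close> the field need not vanish, but the mass carried
along there is zero, up to a null set that the flow pulls back to a null set
(\<open>AE_flow_preimage\<close>).

Uniqueness follows by tracking the support of a solution. The speed of a solution is bounded
on bounded time intervals by its \<open>L\<^sup>1\<close> norm, and the support of \<open>\<rho>\<^sub>o\<close> is compact, hence at positive
distance from the complement of \<open>U\<close>. In a short time the mass cannot leave \<open>U\<close>, so \<open>U\<close> stays at
rest during this time and the density has not changed; time steps of a fixed length then cover
every bounded interval (\<open>solution_is_constant\<close>). So every solution is constant in time, and the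
solution selected by \<open>sol_op\<close> is \<open>\<rho>\<^sub>o\<close> almost everywhere.\<close>

section \<open>Essential supports and essential bounds\<close>

text \<open>The complement of the support is an uncountable union of open sets on each of which \<open>f\<close> vanishes
almost everywhere; by Lindelof countably many of them already cover it, so the exceptional null
sets still add up to a null set.\<close>

lemma AE_nonzero_on_support:
  fixes f :: "'a::euclidean_space \<Rightarrow> 'b::zero"
  shows "AE x in lebesgue. f x \<noteq> 0 \<longrightarrow> x \<in> spt f"
proof -
  define \<F> where "\<F> = {U. open U \<and> (AE x in lebesgue. x \<in> U \<longrightarrow> f x = 0)}"
  obtain \<G> where \<G>: "\<G> \<subseteq> \<F>" "countable \<G>" "\<Union>\<G> = \<Union>\<F>"
    by (rule Lindelof[of \<F>]) (auto simp: \<F>_def)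
  have "AE x in lebesgue. \<forall>U\<in>\<G>. x \<in> U \<longrightarrow> f x = 0"
    using \<G>(1,2) by (subst AE_ball_countable) (auto simp: \<F>_def)
  then show ?thesis
    unfolding spt_def \<F>_def[symmetric] \<G>(3)[symmetric] by eventually_elim auto
qed

lemma closed_spt: "closed (spt f)"
  unfolding spt_def closed_def by auto

lemma AE_all_components:
  fixes P :: "'m::finite \<Rightarrow> 'a \<Rightarrow> bool"
  assumes "\<And>i. AE x in M. P i x"
  shows "AE x in M. \<forall>i. P i x"
  using assms by (simp add: AE_all_countable)

text \<open>The exceptional set is open and null, and a nonempty open set has positive measure. This turns
the almost-everywhere hypotheses on \<open>\<nabla>\<eta>\<close> and \<open>DV\<close> into pointwise ones.\<close>

lemma AE_imp_everywhere_on_open: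
  fixes S :: "'a::euclidean_space set"
  assumes "open S" and "open {x. \<not> P x}" and "AE x in lebesgue. x \<in> S \<longrightarrow> P x" and "x \<in> S"
  shows "P x"
proof -
  have "negligible (S \<inter> {x. \<not> P x})"
    using assms(3) unfolding eventually_ae_filter_negligible
    by (auto elim: negligible_subset)
  moreover have "open (S \<inter> {x. \<not> P x})"
    using assms by auto
  ultimately have "S \<inter> {x. \<not> P x} = {}"
    using open_not_negligible by blast
  then show ?thesis
    using assms(4) by auto
qed

lemma continuous_zero_outside_spt:
  fixes f :: "'a::euclidean_space \<Rightarrow> 'b::real_normed_vector"
  assumes "continuous_on UNIV f" and "x \<notin> spt f"
  shows "f x = 0"
proof -
  obtain S where S: "open S" "x \<in> S" "AE x in lebesgue. x \<in> S \<longrightarrow> f x = 0"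
    using assms(2) unfolding spt_def by auto
  have "open {x. f x \<noteq> 0}"
    using assms(1) by (intro open_Collect_neq continuous_intros)
  then show ?thesis
    using AE_imp_everywhere_on_open[OF S(1) _ S(3) S(2)] by auto
qed

lemma continuous_norm_le_Linf_norm:
  fixes f :: "'a::euclidean_space \<Rightarrow> 'b::real_normed_vector"
  assumes "continuous_on UNIV f" and "Linf_norm f \<le> ereal c"
  shows "norm (f x) \<le> c"
proof -
  have "AE x in lebesgue. ereal (norm (f x)) \<le> Linf_norm f"
    unfolding Linf_norm_def by (rule esssup_AE)
  then have "AE x in lebesgue. x \<in> UNIV \<longrightarrow> norm (f x) \<le> c"
    by eventually_elim (use assms(2) in \<open>auto dest: order_trans\<close>)
  moreover have "open {x. \<not> norm (f x) \<le> c}"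
    using assms(1) unfolding not_le by (intro open_Collect_less continuous_intros)
  ultimately show ?thesis
    using AE_imp_everywhere_on_open[of UNIV "\<lambda>x. norm (f x) \<le> c" x] by auto
qed

lemma Linf_norm_nonneg: "0 \<le> Linf_norm (f :: 'a::euclidean_space \<Rightarrow> 'b::real_normed_vector)"
proof (rule ccontr)
  assume "\<not> 0 \<le> Linf_norm f"
  moreover have "AE x in lebesgue. ereal (norm (f x)) \<le> Linf_norm f"
    unfolding Linf_norm_def by (rule esssup_AE)
  ultimately have "AE x in lebesgue. x \<in> (UNIV::'a set) \<longrightarrow> False"
    by (auto elim!: eventually_mono simp: order_trans[of 0 "ereal (norm (f _))"])
  then show False
    using AE_imp_everywhere_on_open[of UNIV "\<lambda>x. False"] by auto
qed

section \<open>From partial derivatives to Lipschitz bounds\<close>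

lemma lipschitz_if_dpart_bounded:
  fixes f :: "'a::euclidean_space \<Rightarrow> 'b::real_normed_vector" and B :: real
  assumes "\<And>x. f differentiable (at x)" and "\<And>x b. b \<in> Basis \<Longrightarrow> norm (dpart b f x) \<le> B"
  shows "norm (f x - f y) \<le> (DIM('a) * B) * norm (x - y)"
proof -
  let ?D = "\<lambda>x. frechet_derivative f (at x)"
  have D: "(f has_derivative ?D x) (at x)" for x
    using assms(1) by (simp add: frechet_derivative_works[symmetric])
  have "norm (?D x h) \<le> (DIM('a) * B) * norm h" for x h
  proof -
    interpret bounded_linear "?D x"
      using D[of x] by (rule has_derivative_bounded_linear)
    have "?D x h = (\<Sum>b\<in>Basis. (h \<bullet> b) *\<^sub>R dpart b f x)"
      by (subst euclidean_representation[symmetric, of h]) (simp only: sum scale dpart_def)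
    also have "norm \<dots> \<le> (\<Sum>b\<in>(Basis::'a set). norm h * B)"
      by (rule sum_norm_le) (auto intro!: mult_mono assms(2) Basis_le_norm)
    finally show ?thesis
      by (simp add: mult_ac)
  qed
  then have "onorm (?D x) \<le> DIM('a) * B" for x
    by (rule onorm_le)
  then show ?thesis
    using differentiable_bound[of UNIV f ?D "DIM('a) * B" x y] D by auto
qed

lemma dpart_eq_0_if_locally_zero:
  assumes "open S" and "x \<in> S" and "\<And>y. y \<in> S \<Longrightarrow> f y = 0"
  shows "dpart b f x = 0"
proof -
  have "(f has_derivative (\<lambda>h. 0)) (at x)"
    by (rule has_derivative_transform_within_open[where f="\<lambda>x. 0" and s=S]) (use assms in auto)
  then show ?thesis
    unfolding dpart_def by (metis frechet_derivative_at)
qed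

text \<open>The bound on \<open>DV\<close> holds only almost everywhere, but \<open>DV\<close> is continuous, so it holds everywhere.\<close>

lemma V_assm_lipschitz:
  fixes V :: "real^'m^'n \<Rightarrow> real^'m^'n"
  assumes "V_assm V"
  obtains K where "K > 0" "\<And>A B. norm (V A - V B) \<le> K * norm (A - B)"
proof -
  obtain L where L: "L \<ge> 0" "W1inf_norm (matD V) \<le> ereal L"
    using assms unfolding V_assm_def by auto
  have diff: "V differentiable (at x)" for x
    using assms unfolding V_assm_def by (simp add: numeral_2_eq_2)
  have cont: "continuous_on UNIV (dpart b V)" if "b \<in> Basis" for b
    using assms that unfolding V_assm_def 
    by (auto simp: numeral_2_eq_2 intro!: continuous_at_imp_continuous_on differentiable_imp_continuous_within)
  have "Linf_norm (matD V) \<le> W1inf_norm (matD V)"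
    unfolding W1inf_norm_def using Linf_norm_nonneg[of "matD (matD V)"] by (simp add: add_increasing2)
  then have "Linf_norm (matD V) \<le> ereal L"
    using L(2) by simp
  moreover have "continuous_on UNIV (matD V)"
    unfolding matD_def by (intro continuous_on_vec_lambda cont) (auto simp: Basis_vec_def)
  ultimately have bd: "norm (matD V A) \<le> L" for A
    by (intro continuous_norm_le_Linf_norm)
  have "norm (dpart b V A) \<le> L" if "b \<in> Basis" for b A
  proof -
    obtain j i where b: "b = axis j (axis i 1)"
      using \<open>b \<in> Basis\<close> by (auto simp: Basis_vec_def)
    have "norm (dpart b V A) = norm (matD V A $ j $ i)"
      by (simp add: b matD_def)
    also have "\<dots> \<le> norm (matD V A)"
      by (rule order_trans[OF Finite_Cartesian_Product.norm_nth_le Finite_Cartesian_Product.norm_nth_le])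
    finally show ?thesis
      using bd[of A] by simp
  qed
  then have *: "norm (V A - V B) \<le> (DIM(real^'m^'n) * L) * norm (A - B)" for A B
    by (rule lipschitz_if_dpart_bounded[OF diff])
  have "norm (V A - V B) \<le> (DIM(real^'m^'n) * L + 1) * norm (A - B)" for A B
    using *[of A B] norm_ge_zero[of "A - B"] by (simp only: distrib_right mult_1)
  moreover have "DIM(real^'m^'n) * L + 1 > 0"
    using L(1) by (intro add_nonneg_pos mult_nonneg_nonneg) auto
  ultimately show ?thesis
    using that by blast
qed

section \<open>Differentiating a convolution under the integral sign\<close>

lemma quadratic_taylor_bound:
  fixes g :: "'a::euclidean_space \<Rightarrow> real" and C :: real
  assumes "\<And>x. g differentiable (at x)"
    and "\<And>b x y. b \<in> Basis \<Longrightarrow> \<bar>dpart b g x - dpart b g y\<bar> \<le> C * norm (x - y)"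
  shows "\<bar>g y - g x - (\<Sum>b\<in>Basis. ((y - x) \<bullet> b) * dpart b g x)\<bar> \<le> (DIM('a) * C) * (norm (y - x))\<^sup>2"
proof -
  let ?D = "\<lambda>x. frechet_derivative g (at x)"
  have D: "(g has_derivative ?D x) (at x)" for x
    using assms(1) by (simp add: frechet_derivative_works[symmetric])
  have D_eq: "?D x h = (\<Sum>b\<in>Basis. (h \<bullet> b) * dpart b g x)" for x h
  proof -
    interpret bounded_linear "?D x"
      using D[of x] by (rule has_derivative_bounded_linear)
    show ?thesis
      by (subst euclidean_representation[symmetric, of h]) (simp only: sum scale dpart_def real_scaleR_def)
  qed
  have C: "0 \<le> C * norm (y - x)"
    using assms(2)[OF SOME_Basis, of y x] by (meson abs_ge_zero order_trans)
  have "onorm (\<lambda>h. ?D z h - ?D x h) \<le> DIM('a) * (C * norm (y - x))"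
    if z: "z \<in> cball x (norm (y - x))" for z
  proof (rule onorm_le)
    fix h
    have "C * norm (z - x) \<le> C * norm (y - x)"
    proof (cases "y = x")
      case False
      then have "0 \<le> C"
        using C by (simp add: zero_le_mult_iff)
      then show ?thesis
        using z by (intro mult_left_mono) (auto simp: dist_norm norm_minus_commute)
    qed (use z in auto)
    then have le: "\<bar>dpart b g z - dpart b g x\<bar> \<le> C * norm (y - x)" if "b \<in> Basis" for b
      using assms(2)[OF that, of z x] by simp
    have "?D z h - ?D x h = (\<Sum>b\<in>Basis. (h \<bullet> b) * (dpart b g z - dpart b g x))"
      by (simp add: D_eq sum_subtractf[symmetric] algebra_simps)
    also have "norm \<dots> \<le> (\<Sum>b\<in>(Basis::'a set). norm h * (C * norm (y - x)))"
      by (rule sum_norm_le) (auto simp: abs_mult intro!: mult_mono le Basis_le_norm)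
    finally show "norm (?D z h - ?D x h) \<le> DIM('a) * (C * norm (y - x)) * norm h"
      by (simp add: mult_ac)
  qed
  moreover have "x + t *\<^sub>R (y - x) \<in> cball x (norm (y - x))" if "t \<in> {0..1}" for t
    using that by (auto simp: dist_norm intro!: mult_left_le_one_le)
  ultimately have "norm (g y - g x - ?D x (y - x)) \<le> norm (y - x) * (DIM('a) * (C * norm (y - x)))"
    using D by (intro differentiable_bound_linearization[where S="cball x (norm (y - x))" and f'="?D"])
      (auto simp: fun_diff_def intro: has_derivative_at_withinI)
  then show ?thesis
    by (simp add: D_eq power2_eq_square mult_ac)
qed

lemma integrable_conv_kernel:
  fixes f g :: "real^'n \<Rightarrow> real"
  assumes "integrable lebesgue f" "continuous_on UNIV g" "\<And>x. \<bar>g x\<bar> \<le> B"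
  shows "integrable lebesgue (\<lambda>\<xi>. f \<xi> * g (x - \<xi>))"
proof (rule Bochner_Integration.integrable_bound)
  show "integrable lebesgue (\<lambda>\<xi>. B * f \<xi>)"
    using assms(1) by simp
  have "continuous_on UNIV (\<lambda>\<xi>. g (x - \<xi>))"
    by (rule continuous_on_compose2[OF assms(2)]) (auto intro!: continuous_intros)
  then have "(\<lambda>\<xi>. g (x - \<xi>)) \<in> borel_measurable lebesgue"
    by (intro measurable_completion) (simp add: borel_measurable_continuous_onI)
  then show "(\<lambda>\<xi>. f \<xi> * g (x - \<xi>)) \<in> borel_measurable lebesgue"
    using assms(1) by auto
  show "AE \<xi> in lebesgue. norm (f \<xi> * g (x - \<xi>)) \<le> norm (B * f \<xi>)"
    using order_trans[OF assms(3) abs_ge_self]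
    by (intro always_eventually) (auto simp: abs_mult mult.commute[of "\<bar>B\<bar>"] intro!: mult_left_mono)
qed

lemma conv_bound:
  fixes f g :: "real^'n \<Rightarrow> real"
  assumes "integrable lebesgue f" "continuous_on UNIV g" "\<And>x. \<bar>g x\<bar> \<le> B"
  shows "\<bar>conv f g x\<bar> \<le> B * (LINT \<xi>|lebesgue. \<bar>f \<xi>\<bar>)"
proof -
  have "\<bar>conv f g x\<bar> \<le> (LINT \<xi>|lebesgue. B * \<bar>f \<xi>\<bar>)"
    unfolding conv_def real_norm_def[symmetric]
    using assms(1,3) by (intro Bochner_Integration.integral_norm_bound_integral integrable_conv_kernel[OF assms])
      (auto simp: abs_mult mult.commute[of B] intro!: mult_left_mono)
  then show ?thesis
    by simp
qed

lemma conv_lipschitz: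
  fixes f g :: "real^'n \<Rightarrow> real"
  assumes "integrable lebesgue f" "continuous_on UNIV g" "\<And>x. \<bar>g x\<bar> \<le> B"
    and "\<And>x y. \<bar>g x - g y\<bar> \<le> C * norm (x - y)"
  shows "\<bar>conv f g x - conv f g y\<bar> \<le> C * (LINT \<xi>|lebesgue. \<bar>f \<xi>\<bar>) * norm (x - y)"
proof -
  note int = integrable_conv_kernel[OF assms(1-3)]
  have "\<bar>conv f g x - conv f g y\<bar> = \<bar>LINT \<xi>|lebesgue. f \<xi> * g (x - \<xi>) - f \<xi> * g (y - \<xi>)\<bar>"
    unfolding conv_def by (subst Bochner_Integration.integral_diff) (auto intro: int)
  also have "\<dots> \<le> (LINT \<xi>|lebesgue. C * norm (x - y) * \<bar>f \<xi>\<bar>)"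
    unfolding real_norm_def[symmetric]
  proof (rule Bochner_Integration.integral_norm_bound_integral)
    fix \<xi>
    have "\<bar>g (x - \<xi>) - g (y - \<xi>)\<bar> \<le> C * norm (x - y)"
      using assms(4)[of "x - \<xi>" "y - \<xi>"] by simp
    from mult_left_mono[OF this, of "\<bar>f \<xi>\<bar>"]
    show "norm (f \<xi> * g (x - \<xi>) - f \<xi> * g (y - \<xi>)) \<le> C * norm (x - y) * norm (f \<xi>)"
      by (simp add: abs_mult[symmetric] algebra_simps)
  qed (use assms(1) int in auto)
  finally show ?thesis
    by (simp add: mult_ac)
qed

text \<open>A Lipschitz gradient makes the Taylor remainder of \<open>g\<close> quadratic, uniformly in the base point.
Integrating it against \<open>f\<close> leaves a remainder of order \<open>\<parallel>h\<parallel>\<^sup>2\<close> for the convolution; no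
limit has to be interchanged with the integral.\<close>

lemma conv_has_derivative:
  fixes f g :: "real^'n \<Rightarrow> real"
  assumes f: "integrable lebesgue f" and g: "continuous_on UNIV g" "\<And>x. \<bar>g x\<bar> \<le> A"
    and g': "\<And>x. g differentiable (at x)"
    and dg: "\<And>b. b \<in> Basis \<Longrightarrow> continuous_on UNIV (dpart b g)"
      "\<And>b x. b \<in> Basis \<Longrightarrow> \<bar>dpart b g x\<bar> \<le> B"
    and ddg: "\<And>b x y. b \<in> Basis \<Longrightarrow> \<bar>dpart b g x - dpart b g y\<bar> \<le> C * norm (x - y)"
  shows "(conv f g has_derivative (\<lambda>h. \<Sum>b\<in>Basis. (h \<bullet> b) * conv f (dpart b g) x)) (at x)"
proof (rule has_derivativeI_sandwich[of 1])
  let ?L = "\<lambda>h. \<Sum>b\<in>Basis. (h \<bullet> b) * conv f (dpart b g) x"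
  let ?H = "\<lambda>y. DIM(real^'n) * C * (LINT \<xi>|lebesgue. \<bar>f \<xi>\<bar>) * norm (y - x)"
  show "bounded_linear ?L"
    by (intro bounded_linear_sum bounded_linear_mult_const bounded_linear_inner_left)
  have int: "integrable lebesgue (\<lambda>\<xi>. f \<xi> * g (y - \<xi>))" for y
    by (rule integrable_conv_kernel[OF f g])
  have int': "integrable lebesgue (\<lambda>\<xi>. f \<xi> * dpart b g (x - \<xi>))" if "b \<in> Basis" for b
    using dg that by (intro integrable_conv_kernel[OF f])
  fix y assume "y \<noteq> x"
  let ?T = "\<lambda>\<xi>. \<Sum>b\<in>Basis. ((y - x) \<bullet> b) * (f \<xi> * dpart b g (x - \<xi>))"
  have L: "?L (y - x) = (LINT \<xi>|lebesgue. ?T \<xi>)"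
    unfolding conv_def by (subst Bochner_Integration.integral_sum) (auto intro!: integrable_mult_right int')
  have intT: "integrable lebesgue ?T"
    by (intro Bochner_Integration.integrable_sum integrable_mult_right int')
  have "conv f g y - conv f g x - ?L (y - x) =
      (LINT \<xi>|lebesgue. f \<xi> * g (y - \<xi>) - f \<xi> * g (x - \<xi>) - ?T \<xi>)"
    unfolding L using int intT by (simp add: conv_def)
  also have "norm \<dots> \<le> (LINT \<xi>|lebesgue. DIM(real^'n) * C * (norm (y - x))\<^sup>2 * \<bar>f \<xi>\<bar>)"
  proof (rule Bochner_Integration.integral_norm_bound_integral)
    show "integrable lebesgue (\<lambda>\<xi>. f \<xi> * g (y - \<xi>) - f \<xi> * g (x - \<xi>) - ?T \<xi>)"
      using int intT by auto
    fix \<xi>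
    have "\<bar>g (y - \<xi>) - g (x - \<xi>) - (\<Sum>b\<in>Basis. ((y - x) \<bullet> b) * dpart b g (x - \<xi>))\<bar>
        \<le> DIM(real^'n) * C * (norm (y - x))\<^sup>2"
      using quadratic_taylor_bound[OF g' ddg, where x="x - \<xi>" and y="y - \<xi>"] by simp
    from mult_left_mono[OF this, of "\<bar>f \<xi>\<bar>"]
    show "norm (f \<xi> * g (y - \<xi>) - f \<xi> * g (x - \<xi>) - ?T \<xi>)
        \<le> DIM(real^'n) * C * (norm (y - x))\<^sup>2 * \<bar>f \<xi>\<bar>"
      by (simp add: abs_mult[symmetric] right_diff_distrib sum_distrib_left mult_ac)
  qed (use f in auto)
  finally show "norm (conv f g y - conv f g x - ?L (y - x)) / norm (y - x) \<le> ?H y"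
    using \<open>y \<noteq> x\<close> by (simp add: divide_le_eq power2_eq_square mult_ac)
next
  show "((\<lambda>y. DIM(real^'n) * C * (LINT \<xi>|lebesgue. \<bar>f \<xi>\<bar>) * norm (y - x)) \<longlongrightarrow> 0) (at x)"
    by (auto intro!: tendsto_eq_intros)
qed simp

lemma dpart_conv:
  fixes f g :: "real^'n \<Rightarrow> real"
  assumes f: "integrable lebesgue f" and g: "continuous_on UNIV g" "\<And>x. \<bar>g x\<bar> \<le> A"
    and g': "\<And>x. g differentiable (at x)"
    and dg: "\<And>b. b \<in> Basis \<Longrightarrow> continuous_on UNIV (dpart b g)"
      "\<And>b x. b \<in> Basis \<Longrightarrow> \<bar>dpart b g x\<bar> \<le> B"
    and ddg: "\<And>b x y. b \<in> Basis \<Longrightarrow> \<bar>dpart b g x - dpart b g y\<bar> \<le> C * norm (x - y)"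
    and c: "c \<in> Basis"
  shows "dpart c (conv f g) x = conv f (dpart c g) x"
proof -
  have "frechet_derivative (conv f g) (at x) = (\<lambda>h. \<Sum>b\<in>Basis. (h \<bullet> b) * conv f (dpart b g) x)"
    using frechet_derivative_at[OF conv_has_derivative[OF f g g' dg ddg]] by simp
  then have "dpart c (conv f g) x = (\<Sum>b\<in>Basis. (c \<bullet> b) * conv f (dpart b g) x)"
    by (simp add: dpart_def)
  also have "\<dots> = (\<Sum>b\<in>Basis. if b = c then conv f (dpart b g) x else 0)"
    using c by (intro sum.cong) (auto simp: inner_Basis)
  finally show ?thesis
    using c by simp
qed

section \<open>The convolution gradient and the velocity\<close>

text \<open>The gradient is of class \<open>C\<^sup>2\<close> and vanishes outside \<open>ball 0 l\<close>, so it and its first derivatives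
are bounded by compactness; the latter give the Lipschitz bound. The bound on \<open>\<eta>\<close> itself, whose
support may be unbounded, comes from its membership in \<open>L\<^sup>\<infinity>\<close>.\<close>

lemma eta_kernel_bounds:
  fixes \<eta> :: "real^'n \<Rightarrow> real"
  assumes eta: "eta_assm \<eta>" and spt: "spt (grad \<eta>) \<subseteq> ball 0 l - ball 0 r"
  obtains C where "C > 0"
    "continuous_on UNIV \<eta>" "\<And>x. \<bar>\<eta> x\<bar> \<le> C" "\<And>x. \<eta> differentiable (at x)"
    "\<And>b. b \<in> Basis \<Longrightarrow> continuous_on UNIV (dpart b \<eta>)"
    "\<And>b x. b \<in> Basis \<Longrightarrow> \<bar>dpart b \<eta> x\<bar> \<le> C"
    "\<And>b x y. b \<in> Basis \<Longrightarrow> \<bar>dpart b \<eta> x - dpart b \<eta> y\<bar> \<le> C * norm (x - y)"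
    "\<And>b x. b \<in> Basis \<Longrightarrow> norm x < r \<or> l \<le> norm x \<Longrightarrow> dpart b \<eta> x = 0"
proof -
  have d0: "\<eta> differentiable (at x)" for x
    using eta unfolding eta_assm_def by (simp add: numeral_3_eq_3)
  have c0: "continuous_on UNIV \<eta>"
    using d0 by (auto intro!: continuous_at_imp_continuous_on differentiable_imp_continuous_within)
  have d1: "dpart b \<eta> differentiable (at x)" if "b \<in> Basis" for b x
    using eta that unfolding eta_assm_def by (simp add: numeral_3_eq_3)
  then have c1: "continuous_on UNIV (dpart b \<eta>)" if "b \<in> Basis" for b
    using that by (auto intro!: continuous_at_imp_continuous_on differentiable_imp_continuous_within)
  have "dpart c (dpart b \<eta>) differentiable (at x)" if "b \<in> Basis" "c \<in> Basis" for b c x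
    using eta that unfolding eta_assm_def by (simp add: numeral_3_eq_3)
  then have c2: "continuous_on UNIV (dpart c (dpart b \<eta>))" if "b \<in> Basis" "c \<in> Basis" for b c
    using that by (auto intro!: continuous_at_imp_continuous_on differentiable_imp_continuous_within)
  have vanish: "dpart b \<eta> x = 0" if "b \<in> Basis" "norm x < r \<or> l \<le> norm x" for b x
  proof -
    obtain j where b: "b = axis j 1"
      using \<open>b \<in> Basis\<close> by (auto simp: Basis_vec_def)
    have "continuous_on UNIV (grad \<eta>)"
      unfolding grad_def by (intro continuous_on_vec_lambda c1) (auto simp: Basis_vec_def)
    moreover have "x \<notin> spt (grad \<eta>)"
      using that(2) spt by auto
    ultimately have "grad \<eta> x = 0"
      by (rule continuous_zero_outside_spt)
    then have "grad \<eta> x $ j = 0"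
      by simp
    then show ?thesis
      by (simp add: b grad_def)
  qed
  have bdd: "\<exists>B. \<forall>x. \<bar>h x\<bar> \<le> B" if "continuous_on UNIV h" "\<And>x. l < norm x \<Longrightarrow> h x = 0"
    for h :: "real^'n \<Rightarrow> real"
  proof -
    have "bounded (h ` cball 0 l)"
      using that(1) by (intro compact_imp_bounded compact_continuous_image) (auto intro: continuous_on_subset)
    then obtain B where "\<And>x. norm x \<le> l \<Longrightarrow> \<bar>h x\<bar> \<le> B"
      unfolding bounded_iff by (metis image_eqI mem_cball_0 real_norm_def)
    then have "\<bar>h x\<bar> \<le> max B 0" for x
      using that(2)[of x] by (cases "norm x \<le> l") (auto simp: le_max_iff_disj)
    then show ?thesis
      by blast
  qed
  obtain B0 where B0: "\<And>x. \<bar>\<eta> x\<bar> \<le> B0"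
  proof -
    have "Linf_norm \<eta> < \<infinity>"
      using eta unfolding eta_assm_def by (simp add: numeral_3_eq_3 L_inf_def)
    then obtain B where "Linf_norm \<eta> \<le> ereal B"
      using Linf_norm_nonneg[of \<eta>] by (cases "Linf_norm \<eta>") auto
    then show ?thesis
      using continuous_norm_le_Linf_norm[OF c0] that by (metis real_norm_def)
  qed
  have "\<forall>b\<in>Basis. \<exists>B. \<forall>x. \<bar>dpart b \<eta> x\<bar> \<le> B"
    using c1 vanish by (intro ballI bdd) auto
  then obtain B1 where B1: "\<And>b x. b \<in> Basis \<Longrightarrow> \<bar>dpart b \<eta> x\<bar> \<le> B1 b"
    by metis
  have "\<forall>b\<in>Basis. \<forall>c\<in>Basis. \<exists>B. \<forall>x. \<bar>dpart c (dpart b \<eta>) x\<bar> \<le> B"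
  proof (intro ballI bdd c2)
    fix b c x :: "real^'n" assume "b \<in> Basis" "l < norm x"
    then show "dpart c (dpart b \<eta>) x = 0"
      by (intro dpart_eq_0_if_locally_zero[of "- cball 0 l" x "dpart b \<eta>"] vanish) auto
  qed
  then obtain B2 where B2: "\<And>b c x. b \<in> Basis \<Longrightarrow> c \<in> Basis \<Longrightarrow> \<bar>dpart c (dpart b \<eta>) x\<bar> \<le> B2 b c"
    by metis
  define B3 where "B3 b = (\<Sum>c\<in>Basis. \<bar>B2 b c\<bar>)" for b
  have "\<bar>dpart c (dpart b \<eta>) x\<bar> \<le> B3 b" if "b \<in> Basis" "c \<in> Basis" for b c x
    using B2[OF that, of x] member_le_sum[OF that(2), of "\<lambda>c. \<bar>B2 b c\<bar>"] unfolding B3_def by auto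
  then have lip: "\<bar>dpart b \<eta> x - dpart b \<eta> y\<bar> \<le> (DIM(real^'n) * B3 b) * norm (x - y)"
    if "b \<in> Basis" for b x y
    using lipschitz_if_dpart_bounded[OF d1[OF that], of "B3 b" x y] that by simp
  define C where "C = 1 + \<bar>B0\<bar> + (\<Sum>b\<in>Basis. \<bar>B1 b\<bar>) + (\<Sum>b\<in>Basis. \<bar>DIM(real^'n) * B3 b\<bar>)"
  have n1: "0 \<le> (\<Sum>b\<in>Basis. \<bar>B1 b\<bar>)" and n2: "0 \<le> (\<Sum>b\<in>Basis. \<bar>DIM(real^'n) * B3 b\<bar>)"
    by (auto intro: sum_nonneg)
  show ?thesis
  proof (rule that[of C])
    show "C > 0"
      using n1 n2 unfolding C_def by linarith
    show "\<bar>\<eta> x\<bar> \<le> C" for x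
      using B0[of x] n1 n2 unfolding C_def by linarith
    show "\<bar>dpart b \<eta> x\<bar> \<le> C" if "b \<in> Basis" for b x
    proof -
      have "\<bar>B1 b\<bar> \<le> (\<Sum>b\<in>Basis. \<bar>B1 b\<bar>)"
        using that by (intro member_le_sum) auto
      then show ?thesis
        using B1[OF that, of x] n2 unfolding C_def by linarith
    qed
    show "\<bar>dpart b \<eta> x - dpart b \<eta> y\<bar> \<le> C * norm (x - y)" if "b \<in> Basis" for b x y
    proof -
      have "\<bar>DIM(real^'n) * B3 b\<bar> \<le> (\<Sum>b\<in>Basis. \<bar>DIM(real^'n) * B3 b\<bar>)"
        using that by (intro member_le_sum) auto
      then have "DIM(real^'n) * B3 b \<le> C"
        using n1 unfolding C_def by linarith
      then show ?thesis
        using lip[OF that, of x y] mult_right_mono[OF _ norm_ge_zero] order_trans by blast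
    qed
  qed (use c0 d0 c1 vanish in auto)
qed

lemma matrix_norm_le:
  fixes A :: "real^'m^'n" and c :: real
  assumes "\<And>j i. \<bar>A $ j $ i\<bar> \<le> c"
  shows "norm A \<le> CARD('n) * CARD('m) * c"
proof -
  have "norm (A $ j) \<le> CARD('m) * c" for j
  proof -
    have "norm (A $ j) \<le> (\<Sum>i\<in>(UNIV::'m set). \<bar>A $ j $ i\<bar>)"
      by (rule norm_le_l1_cart)
    also have "\<dots> \<le> (\<Sum>i\<in>(UNIV::'m set). c)"
      by (intro sum_mono assms)
    finally show ?thesis
      by simp
  qed
  then have "(\<Sum>j\<in>(UNIV::'n set). norm (A $ j)) \<le> (\<Sum>j\<in>(UNIV::'n set). CARD('m) * c)"
    by (intro sum_mono)
  moreover have "norm A \<le> (\<Sum>j\<in>(UNIV::'n set). norm (A $ j))"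
    unfolding norm_vec_def by (rule L2_set_le_sum) auto
  ultimately show ?thesis
    by simp
qed

lemma column_norm_le: "norm (column i A) \<le> norm (A :: real^'m^'n)"
proof -
  have "norm (A $ j $ i) \<le> norm (A $ j)" for j
    by (rule Finite_Cartesian_Product.norm_nth_le)
  then show ?thesis
    unfolding norm_vec_def[of A] norm_vec_def[of "column i A"]
    by (intro L2_set_mono) (auto simp: column_def)
qed

lemma grad_conv_eq:
  fixes \<eta> :: "real^'n \<Rightarrow> real" and \<rho> :: "real^'n \<Rightarrow> real^'m"
  assumes "eta_assm \<eta>" and "spt (grad \<eta>) \<subseteq> ball 0 l - ball 0 r"
    and "integrable lebesgue \<rho>"
  shows "grad_conv \<rho> \<eta> x $ j $ i = conv (\<lambda>\<xi>. \<rho> \<xi> $ i) (dpart (axis j 1) \<eta>) x"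
proof -
  obtain C where C: "C > 0"
    "continuous_on UNIV \<eta>" "\<And>x. \<bar>\<eta> x\<bar> \<le> C" "\<And>x. \<eta> differentiable (at x)"
    "\<And>b. b \<in> Basis \<Longrightarrow> continuous_on UNIV (dpart b \<eta>)"
    "\<And>b x. b \<in> Basis \<Longrightarrow> \<bar>dpart b \<eta> x\<bar> \<le> C"
    "\<And>b x y. b \<in> Basis \<Longrightarrow> \<bar>dpart b \<eta> x - dpart b \<eta> y\<bar> \<le> C * norm (x - y)"
    by (rule eta_kernel_bounds[OF assms(1,2)]) blast
  have "integrable lebesgue (\<lambda>\<xi>. \<rho> \<xi> $ i)"
    using integrable_bounded_linear[OF bounded_linear_vec_nth assms(3)] .
  then have "dpart (axis j 1) (conv (\<lambda>\<xi>. \<rho> \<xi> $ i) \<eta>) x = conv (\<lambda>\<xi>. \<rho> \<xi> $ i) (dpart (axis j 1) \<eta>) x"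
    using C(2-) by (rule dpart_conv) (auto simp: Basis_vec_def)
  then show ?thesis
    by (simp add: grad_conv_def)
qed

text \<open>The mass \<open>\<parallel>\<rho>\<parallel>\<close> in \<open>L\<^sup>1\<close> is the only feature of the density that enters these bounds. It is
locally bounded in time along a solution, which makes the bounds on its velocity locally uniform
in time.\<close>

lemma grad_conv_estimates:
  fixes \<eta> :: "real^'n \<Rightarrow> real"
  assumes "eta_assm \<eta>" and "spt (grad \<eta>) \<subseteq> ball 0 l - ball 0 r"
  obtains C where "C > 0"
    "\<And>(\<rho> :: real^'n \<Rightarrow> real^'m) x. integrable lebesgue \<rho> \<Longrightarrow>
       norm (grad_conv \<rho> \<eta> x) \<le> C * (LINT \<xi>|lebesgue. norm (\<rho> \<xi>))"
    "\<And>(\<rho> :: real^'n \<Rightarrow> real^'m) x y. integrable lebesgue \<rho> \<Longrightarrow>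
       norm (grad_conv \<rho> \<eta> x - grad_conv \<rho> \<eta> y) \<le> C * (LINT \<xi>|lebesgue. norm (\<rho> \<xi>)) * norm (x - y)"
proof -
  obtain C where C: "C > 0"
    "\<And>b. b \<in> Basis \<Longrightarrow> continuous_on UNIV (dpart b \<eta>)"
    "\<And>b x. b \<in> Basis \<Longrightarrow> \<bar>dpart b \<eta> x\<bar> \<le> C"
    "\<And>b x y. b \<in> Basis \<Longrightarrow> \<bar>dpart b \<eta> x - dpart b \<eta> y\<bar> \<le> C * norm (x - y)"
    by (rule eta_kernel_bounds[OF assms(1,2)]) blast
  have basis: "axis j 1 \<in> (Basis :: (real^'n) set)" for j
    by (auto simp: Basis_vec_def)
  let ?N = "\<lambda>\<rho> :: real^'n \<Rightarrow> real^'m. LINT \<xi>|lebesgue. norm (\<rho> \<xi>)"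
  have int: "integrable lebesgue (\<lambda>\<xi>. \<rho> \<xi> $ i)" if "integrable lebesgue \<rho>" for \<rho> :: "real^'n \<Rightarrow> real^'m" and i
    using integrable_bounded_linear[OF bounded_linear_vec_nth that] .
  have comp: "(LINT \<xi>|lebesgue. \<bar>\<rho> \<xi> $ i\<bar>) \<le> ?N \<rho>" if "integrable lebesgue \<rho>" for \<rho> i
    using int[OF that] that by (intro integral_mono) (auto simp: component_le_norm_cart)
  show ?thesis
  proof (rule that[of "CARD('n) * CARD('m) * C"])
    show "0 < CARD('n) * CARD('m) * C"
      using \<open>C > 0\<close> by simp
    fix \<rho> :: "real^'n \<Rightarrow> real^'m" and x y assume \<rho>: "integrable lebesgue \<rho>"
    note eq = grad_conv_eq[OF assms \<rho>]
    have "\<bar>grad_conv \<rho> \<eta> x $ j $ i\<bar> \<le> C * ?N \<rho>" for j i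
    proof -
      have "\<bar>grad_conv \<rho> \<eta> x $ j $ i\<bar> \<le> C * (LINT \<xi>|lebesgue. \<bar>\<rho> \<xi> $ i\<bar>)"
        using conv_bound[OF int[OF \<rho>, of i] C(2,3)[OF basis[of j]], of x] by (simp add: eq)
      also have "\<dots> \<le> C * ?N \<rho>"
        using \<open>C > 0\<close> by (intro mult_left_mono comp \<rho>) auto
      finally show ?thesis .
    qed
    then show "norm (grad_conv \<rho> \<eta> x) \<le> CARD('n) * CARD('m) * C * ?N \<rho>"
      using matrix_norm_le[of "grad_conv \<rho> \<eta> x" "C * ?N \<rho>"] by (simp add: mult_ac)
    have "\<bar>(grad_conv \<rho> \<eta> x - grad_conv \<rho> \<eta> y) $ j $ i\<bar> \<le> C * ?N \<rho> * norm (x - y)" for j i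
    proof -
      have "\<bar>(grad_conv \<rho> \<eta> x - grad_conv \<rho> \<eta> y) $ j $ i\<bar>
          \<le> C * (LINT \<xi>|lebesgue. \<bar>\<rho> \<xi> $ i\<bar>) * norm (x - y)"
        using conv_lipschitz[OF int[OF \<rho>, of i] C(2,3,4)[OF basis[of j]], of x y] by (simp add: eq)
      also have "\<dots> \<le> C * ?N \<rho> * norm (x - y)"
        using \<open>C > 0\<close> by (intro mult_right_mono mult_left_mono comp \<rho>) auto
      finally show ?thesis .
    qed
    then show "norm (grad_conv \<rho> \<eta> x - grad_conv \<rho> \<eta> y) \<le> CARD('n) * CARD('m) * C * ?N \<rho> * norm (x - y)"
      using matrix_norm_le[of "grad_conv \<rho> \<eta> x - grad_conv \<rho> \<eta> y" "C * ?N \<rho> * norm (x - y)"]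
      by (simp add: mult_ac)
  qed
qed

text \<open>A density carried by \<open>U\<close> exerts no influence at points of \<open>U\<close>: the differences of points of
\<open>U\<close> avoid the shell \<open>r \<le> \<parallel>z\<parallel> < l\<close>, outside of which \<open>\<nabla>\<eta>\<close> vanishes.\<close>

lemma grad_conv_vanishes:
  fixes \<eta> :: "real^'n \<Rightarrow> real" and \<rho> :: "real^'n \<Rightarrow> real^'m"
  assumes "eta_assm \<eta>" and "spt (grad \<eta>) \<subseteq> ball 0 l - ball 0 r"
    and "integrable lebesgue \<rho>"
    and "AE \<xi> in lebesgue. \<rho> \<xi> \<noteq> 0 \<longrightarrow> \<xi> \<in> U"
    and "\<And>p q. p \<in> U \<Longrightarrow> q \<in> U \<Longrightarrow> norm (p - q) < r \<or> l \<le> norm (p - q)"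
    and "x \<in> U"
  shows "grad_conv \<rho> \<eta> x = 0"
proof -
  have vanish: "\<And>b x. b \<in> Basis \<Longrightarrow> norm x < r \<or> l \<le> norm x \<Longrightarrow> dpart b \<eta> x = 0"
    by (rule eta_kernel_bounds[OF assms(1,2)]) blast
  have "grad_conv \<rho> \<eta> x $ j $ i = 0" for j i
  proof -
    have "AE \<xi> in lebesgue. \<rho> \<xi> $ i * dpart (axis j 1) \<eta> (x - \<xi>) = 0"
      using assms(4)
    proof eventually_elim
      case (elim \<xi>)
      have "dpart (axis j 1) \<eta> (x - \<xi>) = 0" if "\<xi> \<in> U"
        using assms(5)[OF \<open>x \<in> U\<close> that] by (intro vanish) (auto simp: Basis_vec_def)
      then show ?case
        using elim by (cases "\<rho> \<xi> = 0") auto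
    qed
    then show ?thesis
      unfolding grad_conv_eq[OF assms(1-3)] conv_def by (rule integral_eq_zero_AE)
  qed
  then show ?thesis
    by (simp add: vec_eq_iff)
qed

lemma velocity_estimates:
  fixes V :: "real^'m^'n \<Rightarrow> real^'m^'n" and \<eta> :: "real^'n \<Rightarrow> real"
  assumes "V_assm V" and "eta_assm \<eta>" and "spt (grad \<eta>) \<subseteq> ball 0 l - ball 0 r"
  obtains C where "C > 0"
    "\<And>\<rho> i t p. integrable lebesgue (\<rho> t) \<Longrightarrow>
       norm (velocity V \<eta> \<rho> i t p) \<le> C * (LINT \<xi>|lebesgue. norm (\<rho> t \<xi>))"
    "\<And>\<rho> i t p q. integrable lebesgue (\<rho> t) \<Longrightarrow>
       norm (velocity V \<eta> \<rho> i t p - velocity V \<eta> \<rho> i t q)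
         \<le> C * (LINT \<xi>|lebesgue. norm (\<rho> t \<xi>)) * norm (p - q)"
proof -
  obtain K where K: "K > 0" "\<And>A B. norm (V A - V B) \<le> K * norm (A - B)"
    by (rule V_assm_lipschitz[OF assms(1)]) blast
  obtain C where C: "C > 0"
    "\<And>(\<rho> :: real^'n \<Rightarrow> real^'m) x. integrable lebesgue \<rho> \<Longrightarrow>
       norm (grad_conv \<rho> \<eta> x) \<le> C * (LINT \<xi>|lebesgue. norm (\<rho> \<xi>))"
    "\<And>(\<rho> :: real^'n \<Rightarrow> real^'m) x y. integrable lebesgue \<rho> \<Longrightarrow>
       norm (grad_conv \<rho> \<eta> x - grad_conv \<rho> \<eta> y) \<le> C * (LINT \<xi>|lebesgue. norm (\<rho> \<xi>)) * norm (x - y)"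
    by (rule grad_conv_estimates[OF assms(2,3)]) blast
  have col: "norm (column i (V A) - column i (V B)) \<le> K * norm (A - B)" for i A B
  proof -
    have "column i (V A) - column i (V B) = column i (V A - V B)"
      by (simp add: column_def vec_eq_iff)
    then show ?thesis
      using column_norm_le[of i "V A - V B"] K(2)[of A B] by simp
  qed
  have "V 0 = 0"
    using assms(1) by (simp add: V_assm_def)
  then have col0: "norm (column i (V A)) \<le> K * norm A" for i A
    using col[of i A 0] by (simp add: column_def zero_vec_def[symmetric])
  show ?thesis
  proof (rule that[of "K * C"])
    show "K * C > 0"
      using K C by simp
    fix \<rho> :: "real \<Rightarrow> real^'n \<Rightarrow> real^'m" and i t p q
    assume int: "integrable lebesgue (\<rho> t)"
    show "norm (velocity V \<eta> \<rho> i t p) \<le> K * C * (LINT \<xi>|lebesgue. norm (\<rho> t \<xi>))"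
      using order_trans[OF col0 mult_left_mono[OF C(2)[OF int]]] \<open>K > 0\<close>
      by (simp add: velocity_def mult.assoc)
    show "norm (velocity V \<eta> \<rho> i t p - velocity V \<eta> \<rho> i t q)
        \<le> K * C * (LINT \<xi>|lebesgue. norm (\<rho> t \<xi>)) * norm (p - q)"
      using order_trans[OF col mult_left_mono[OF C(3)[OF int]]] \<open>K > 0\<close>
      by (simp add: velocity_def mult.assoc)
  qed
qed

lemma velocity_vanishes:
  assumes "V_assm V" and "grad_conv (\<rho> t) \<eta> p = 0"
  shows "velocity V \<eta> \<rho> i t p = 0"
  using assms by (simp add: velocity_def V_assm_def column_def zero_vec_def)

section \<open>Uniqueness for characteristics and null sets\<close>

text \<open>The function \<open>exp (- 2 L s) \<parallel>w s\<parallel>\<^sup>2\<close> has nonpositive derivative. The differential form, with \<open>w'\<close>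
merely a derivative, avoids any integral of the velocity along a characteristic.\<close>

lemma gronwall_forward:
  fixes w :: "real \<Rightarrow> 'a::real_inner"
  assumes "a \<le> b"
    and w: "\<And>s. a \<le> s \<Longrightarrow> s \<le> b \<Longrightarrow> (w has_vector_derivative w' s) (at s)"
    and w': "\<And>s. a \<le> s \<Longrightarrow> s \<le> b \<Longrightarrow> norm (w' s) \<le> L * norm (w s)"
  shows "norm (w b) \<le> exp (L * (b - a)) * norm (w a)"
proof -
  define f where "f s = exp (- (2 * L * s)) * (w s \<bullet> w s)" for s
  have "f b \<le> f a"
  proof (rule DERIV_nonpos_imp_nonincreasing[OF \<open>a \<le> b\<close>])
    fix s assume s: "a \<le> s" "s \<le> b"
    have "(f has_real_derivative exp (- (2 * L * s)) * (2 * (w s \<bullet> w' s) - 2 * L * (w s \<bullet> w s))) (at s)"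
    proof -
      have "((\<lambda>s. w s \<bullet> w s) has_real_derivative 2 * (w s \<bullet> w' s)) (at s)"
        unfolding has_field_derivative_def
        using has_derivative_inner[OF w[OF s, unfolded has_vector_derivative_def]
            w[OF s, unfolded has_vector_derivative_def]]
        by (rule has_derivative_eq_rhs) (auto simp: inner_commute algebra_simps)
      then show ?thesis
        unfolding f_def by (auto intro!: derivative_eq_intros simp: algebra_simps)
    qed
    moreover have "w s \<bullet> w' s \<le> L * (w s \<bullet> w s)"
    proof -
      have "w s \<bullet> w' s \<le> norm (w s) * norm (w' s)"
        by (rule norm_cauchy_schwarz)
      also have "\<dots> \<le> norm (w s) * (L * norm (w s))"
        by (intro mult_left_mono w' s norm_ge_zero)
      finally show ?thesis
        by (simp add: dot_square_norm power2_eq_square mult_ac)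
    qed
    ultimately show "\<exists>y. (f has_real_derivative y) (at s) \<and> y \<le> 0"
      by (intro exI conjI) (auto intro!: mult_nonneg_nonpos)
  qed
  then have "exp (2 * L * b) * f b \<le> exp (2 * L * b) * f a"
    by simp
  then have "(norm (w b))\<^sup>2 \<le> exp (2 * L * b) * (exp (- (2 * L * a)) * (norm (w a))\<^sup>2)"
    by (simp add: f_def dot_square_norm exp_minus field_simps)
  also have "\<dots> = (exp (L * (b - a)) * norm (w a))\<^sup>2"
    by (simp add: power_mult_distrib power2_eq_square exp_add[symmetric] algebra_simps)
  finally show ?thesis
    by (rule power2_le_imp_le) simp
qed

lemma gronwall:
  fixes w :: "real \<Rightarrow> 'a::real_inner"
  assumes w: "\<And>s. s \<in> closed_segment a b \<Longrightarrow> (w has_vector_derivative w' s) (at s)"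
    and w': "\<And>s. s \<in> closed_segment a b \<Longrightarrow> norm (w' s) \<le> L * norm (w s)"
  shows "norm (w b) \<le> exp (L * \<bar>b - a\<bar>) * norm (w a)"
proof (cases "a \<le> b")
  case True
  then show ?thesis
    using gronwall_forward[of a b w w' L] assms by (auto simp: closed_segment_eq_real_ivl)
next
  case False
  have "((\<lambda>s. w (- s)) has_vector_derivative - w' (- s)) (at s)" if "- a \<le> s" "s \<le> - b" for s
  proof -
    have "(w has_vector_derivative w' (- s)) (at (- s))"
      using that by (intro w) (auto simp: closed_segment_eq_real_ivl)
    then have "((w \<circ> uminus) has_vector_derivative (-1) *\<^sub>R w' (- s)) (at s)"
      by (intro vector_diff_chain_at) (auto intro!: derivative_eq_intros)
    then show ?thesis
      by (simp add: comp_def)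
  qed
  moreover have "norm (- w' (- s)) \<le> L * norm (w (- s))" if "- a \<le> s" "s \<le> - b" for s
    using that w'[of "- s"] by (auto simp: closed_segment_eq_real_ivl)
  ultimately show ?thesis
    using gronwall_forward[of "- a" "- b" "\<lambda>s. w (- s)" "\<lambda>s. - w' (- s)" L] False by simp
qed

text \<open>Gronwall is run from time \<open>0\<close> to time \<open>t\<close>, where the two characteristics pass through \<open>x\<close> and
\<open>y\<close>: the inverse of \<open>X 0 t\<close> is Lipschitz.\<close>

lemma flow_injective_estimate:
  assumes "is_flow UNIV v X"
    and "\<And>s p q. \<bar>s\<bar> \<le> T \<Longrightarrow> norm (v s p - v s q) \<le> L * norm (p - q)"
    and "\<bar>t\<bar> \<le> T"
  shows "norm (x - y) \<le> exp (L * \<bar>t\<bar>) * norm (X 0 t x - X 0 t y)"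
proof -
  have X: "X t t z = z" "((\<lambda>s. X s t z) has_vector_derivative v s (X s t z)) (at s)" for s z
    using assms(1) unfolding is_flow_def by auto
  have seg: "\<bar>s\<bar> \<le> T" if "s \<in> closed_segment 0 t" for s
    using that assms(3) by (auto simp: closed_segment_eq_real_ivl split: if_splits)
  have "norm (X t t x - X t t y) \<le> exp (L * \<bar>t - 0\<bar>) * norm (X 0 t x - X 0 t y)"
    by (rule gronwall[where w'="\<lambda>s. v s (X s t x) - v s (X s t y)"])
      (auto intro!: has_vector_derivative_diff X assms(2) seg)
  then show ?thesis
    by (simp add: X)
qed

text \<open>An exceptional null set pulls back to a null set because the preimage is its image under the
Lipschitz inverse of \<open>X 0 t\<close>. Initial data are only determined almost everywhere, so every
statement about \<open>\<rho>\<^sub>o (X 0 t x)\<close> depends on this.\<close>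

lemma AE_flow_preimage:
  fixes X :: "real \<Rightarrow> real \<Rightarrow> real^'n \<Rightarrow> real^'n"
  assumes "is_flow UNIV v X"
    and "\<And>s p q. \<bar>s\<bar> \<le> T \<Longrightarrow> norm (v s p - v s q) \<le> L * norm (p - q)"
    and "\<bar>t\<bar> \<le> T"
    and "AE y in lebesgue. P y"
  shows "AE x in lebesgue. P (X 0 t x)"
proof -
  note est = flow_injective_estimate[OF assms(1,2,3)]
  obtain N where N: "negligible N" "{y. \<not> P y} \<subseteq> N"
    using assms(4) unfolding eventually_ae_filter_negligible by auto
  have inj: "inj (X 0 t)"
  proof (rule injI)
    fix x y assume "X 0 t x = X 0 t y"
    then show "x = y"
      using est[of x y] by simp
  qed
  \<comment> \<open>Outside the range of \<open>X 0 t\<close> the values of its inverse are arbitrary.\<close>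
  define N' where "N' = N \<inter> range (X 0 t)"
  have "negligible (inv (X 0 t) ` N')"
  proof (rule negligible_locally_Lipschitz_image)
    show "negligible N'"
      using N(1) unfolding N'_def by (rule negligible_Int[OF disjI1])
    fix p assume "p \<in> N'"
    have "norm (inv (X 0 t) q - inv (X 0 t) p) \<le> exp (L * \<bar>t\<bar>) * norm (q - p)" if "q \<in> N'" for q
      using est[of "inv (X 0 t) q" "inv (X 0 t) p"] that \<open>p \<in> N'\<close> unfolding N'_def
      by (simp add: f_inv_into_f)
    then show "\<exists>T B. open T \<and> p \<in> T \<and>
        (\<forall>q\<in>N' \<inter> T. norm (inv (X 0 t) q - inv (X 0 t) p) \<le> B * norm (q - p))"
      by (intro exI[of _ UNIV] exI[of _ "exp (L * \<bar>t\<bar>)"]) auto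
  qed simp
  moreover have "{x. \<not> P (X 0 t x)} \<subseteq> inv (X 0 t) ` N'"
  proof
    fix x assume "x \<in> {x. \<not> P (X 0 t x)}"
    then have "X 0 t x \<in> N'"
      using N(2) unfolding N'_def by auto
    then show "x \<in> inv (X 0 t) ` N'"
      using inv_f_f[OF inj] by (metis image_eqI)
  qed
  ultimately show ?thesis
    unfolding eventually_ae_filter_negligible by auto
qed

text \<open>The second hypothesis is what the Lipschitz bound of \<open>v s\<close> gives when \<open>v s\<close> vanishes at the
starting point \<open>\<gamma> a\<close>. The curve is then compared with the constant curve through that point.\<close>

lemma stays_at_rest:
  fixes \<gamma> :: "real \<Rightarrow> 'a::real_inner"
  assumes "\<And>s. s \<in> closed_segment a b \<Longrightarrow> (\<gamma> has_vector_derivative v s (\<gamma> s)) (at s)"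
    and "\<And>s q. s \<in> closed_segment a b \<Longrightarrow> norm (v s q) \<le> L * norm (q - \<gamma> a)"
  shows "\<gamma> b = \<gamma> a"
proof -
  have "norm (\<gamma> b - \<gamma> a) \<le> exp (L * \<bar>b - a\<bar>) * norm (\<gamma> a - \<gamma> a)"
    by (rule gronwall[where w'="\<lambda>s. v s (\<gamma> s)"]) (auto intro!: derivative_eq_intros assms)
  then show ?thesis
    by simp
qed

section \<open>Global flow of a Lipschitz vector field\<close>

lemma primitive_exp_bound_forward:
  fixes D :: "real \<Rightarrow> 'a::real_normed_vector"
  assumes "\<And>s. (D has_vector_derivative D' s) (at s)"
    and "\<And>s. norm (D' s) \<le> c * exp (K * \<bar>s\<bar>)" and "K > 0" and "t \<ge> 0"
  shows "norm (D t - D 0) \<le> c / K * (exp (K * t) - 1)"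
proof (cases "t = 0")
  case False
  have "norm (D t - D 0) \<le> c / K * exp (K * t) - c / K * exp (K * 0)"
  proof (rule differentiable_bound_general[where f'=D' and \<phi>'="\<lambda>s. c * exp (K * s)"])
    show "continuous_on {0..t} D"
      using assms(1) by (meson continuous_at_imp_continuous_on has_vector_derivative_continuous)
    show "continuous_on {0..t} (\<lambda>s. c / K * exp (K * s))"
      by (intro continuous_intros)
    fix s :: real assume "0 < s"
    then show "norm (D' s) \<le> c * exp (K * s)"
      using assms(2)[of s] by simp
    show "((\<lambda>s. c / K * exp (K * s)) has_vector_derivative c * exp (K * s)) (at s)"
      using \<open>K > 0\<close> unfolding has_real_derivative_iff_has_vector_derivative[symmetric]
      by (auto intro!: derivative_eq_intros)
  qed (use assms False in auto)
  then show ?thesis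
    by (simp add: right_diff_distrib)
qed simp

text \<open>In the weight \<open>exp (K \<bar>t\<bar>)\<close>, integration from \<open>0\<close> divides bounds by \<open>K\<close>. This is what makes
the Picard operator below a contraction.\<close>

lemma primitive_exp_bound:
  fixes D :: "real \<Rightarrow> 'a::real_normed_vector"
  assumes "\<And>s. (D has_vector_derivative D' s) (at s)" and "D 0 = 0"
    and "\<And>s. norm (D' s) \<le> c * exp (K * \<bar>s\<bar>)" and "K > 0"
  shows "exp (- (K * \<bar>t\<bar>)) * norm (D t) \<le> c / K"
proof -
  have "0 \<le> c"
    using assms(3)[of 0] norm_ge_zero order_trans by (metis abs_zero exp_zero mult.right_neutral mult_zero_right)
  have "norm (D t) \<le> c / K * (exp (K * \<bar>t\<bar>) - 1)"
  proof (cases "t \<ge> 0")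
    case True
    then show ?thesis
      using primitive_exp_bound_forward[of D D' c K t] assms by simp
  next
    case False
    have "((\<lambda>s. D (- s)) has_vector_derivative - D' (- s)) (at s)" for s
    proof -
      have "((D \<circ> uminus) has_vector_derivative (-1) *\<^sub>R D' (- s)) (at s)"
        by (intro vector_diff_chain_at assms) (auto intro!: derivative_eq_intros)
      then show ?thesis
        by (simp add: comp_def)
    qed
    moreover have "norm (- D' (- s)) \<le> c * exp (K * \<bar>s\<bar>)" for s
      using assms(3)[of "- s"] by simp
    ultimately show ?thesis
      using primitive_exp_bound_forward[of "\<lambda>s. D (- s)" "\<lambda>s. - D' (- s)" c K "- t"] assms(2,4) False
      by simp
  qed
  also have "\<dots> \<le> c / K * exp (K * \<bar>t\<bar>)"
    using \<open>0 \<le> c\<close> \<open>K > 0\<close> by (intro mult_left_mono) auto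
  finally show ?thesis
    by (simp add: exp_minus field_simps)
qed

text \<open>Picard iteration on all of \<open>\<real>\<close> at once. Curves are written as \<open>y t = exp (K \<bar>t\<bar>) z t\<close> with \<open>z\<close>
bounded and continuous. In the sup norm of \<open>z\<close> the integral operator has Lipschitz constant
\<open>L / K\<close>, hence \<open>1 / 2\<close> for \<open>K = 2 L\<close>, and Banach's theorem gives a global solution without
continuation of local ones.\<close>

lemma lipschitz_ode_global_solution:
  fixes v :: "'a::euclidean_space \<Rightarrow> 'a"
  assumes "L > 0" and lip: "\<And>p q. norm (v p - v q) \<le> L * norm (p - q)"
  shows "\<exists>y. y 0 = x \<and> (\<forall>t. (y has_vector_derivative v (y t)) (at t))"
proof -
  define K where "K = 2 * L"
  have K: "K > 0"
    using \<open>L > 0\<close> by (simp add: K_def)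
  have cont_v: "continuous_on UNIV v"
  proof (rule lipschitz_on_continuous_on)
    show "L-lipschitz_on UNIV v"
      using lip \<open>L > 0\<close> by (auto simp: lipschitz_on_def dist_norm)
  qed
  define curve where "curve z t = exp (K * \<bar>t\<bar>) *\<^sub>R apply_bcontfun z t" for z :: "real \<Rightarrow>\<^sub>C 'a" and t
  have cont_curve: "continuous_on UNIV (\<lambda>t. v (curve z t))" for z
    unfolding curve_def
    by (rule continuous_on_compose2[OF cont_v]) (auto intro!: continuous_intros)
  have "\<exists>J. J 0 = 0 \<and> (\<forall>t. (J has_vector_derivative v (curve z t)) (at t))" for z
  proof -
    have "\<exists>F. \<forall>t::real. - \<infinity> < ereal t \<longrightarrow> ereal t < \<infinity> \<longrightarrow> (F has_vector_derivative v (curve z t)) (at t)"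
      by (rule einterval_antiderivative)
        (use cont_curve[of z] in \<open>auto simp: continuous_on_eq_continuous_at\<close>)
    then obtain F where F: "\<And>t. (F has_vector_derivative v (curve z t)) (at t)"
      by auto
    show ?thesis
      by (intro exI[of _ "\<lambda>t. F t - F 0"]) (auto intro!: derivative_eq_intros F)
  qed
  then obtain J where J0: "\<And>z. J z 0 = 0"
    and J: "\<And>z t. (J z has_vector_derivative v (curve z t)) (at t)"
    by metis
  have curve_diff: "norm (v (curve z s) - v (curve w s)) \<le> (L * dist z w) * exp (K * \<bar>s\<bar>)" for z w s
  proof -
    have "norm (v (curve z s) - v (curve w s)) \<le> L * norm (curve z s - curve w s)"
      by (rule lip)
    also have "norm (curve z s - curve w s) = exp (K * \<bar>s\<bar>) * dist (apply_bcontfun z s) (apply_bcontfun w s)"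
      by (simp add: curve_def dist_norm scaleR_diff_right[symmetric])
    also have "\<dots> \<le> exp (K * \<bar>s\<bar>) * dist z w"
      by (intro mult_left_mono dist_bounded) auto
    finally show ?thesis
      using \<open>L > 0\<close> by (simp add: mult_ac)
  qed
  define \<Psi> where "\<Psi> z t = exp (- (K * \<bar>t\<bar>)) *\<^sub>R (x + J z t)" for z t
  have \<Psi>: "\<Psi> z \<in> bcontfun" for z
  proof -
    have "continuous_on UNIV (J z)"
      using J by (meson continuous_at_imp_continuous_on has_vector_derivative_continuous)
    then have "continuous_on UNIV (\<Psi> z)"
      unfolding \<Psi>_def by (intro continuous_intros)
    moreover have "norm (\<Psi> z t) \<le> norm x + (norm (v 0) + L * dist z 0) / K" for t
    proof -
      have "exp (- (K * \<bar>t\<bar>)) * norm (J z t) \<le> (norm (v 0) + L * dist z 0) / K"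
      proof (rule primitive_exp_bound[OF J J0 _ K])
        fix s
        have "curve 0 s = 0"
          by (simp add: curve_def)
        have "norm (v (curve z s)) \<le> norm (v 0) + norm (v (curve z s) - v (curve 0 s))"
          using norm_triangle_ineq[of "v 0" "v (curve z s) - v 0"] \<open>curve 0 s = 0\<close> by simp
        also have "\<dots> \<le> norm (v 0) * exp (K * \<bar>s\<bar>) + L * dist z 0 * exp (K * \<bar>s\<bar>)"
          using K by (intro add_mono curve_diff) (simp add: mult_le_cancel_left1)
        finally show "norm (v (curve z s)) \<le> (norm (v 0) + L * dist z 0) * exp (K * \<bar>s\<bar>)"
          by (simp add: distrib_right)
      qed
      moreover have "exp (- (K * \<bar>t\<bar>)) * norm x \<le> norm x"
        using K by (intro mult_left_le_one_le) auto
      moreover have "norm (\<Psi> z t) \<le> exp (- (K * \<bar>t\<bar>)) * norm x + exp (- (K * \<bar>t\<bar>)) * norm (J z t)"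
        unfolding \<Psi>_def by (simp add: distrib_left[symmetric] norm_triangle_ineq)
      ultimately show ?thesis
        by linarith
    qed
    then have "bounded (range (\<Psi> z))"
      unfolding bounded_iff by blast
    ultimately show ?thesis
      by (simp add: bcontfun_def)
  qed
  have "dist (Bcontfun (\<Psi> z)) (Bcontfun (\<Psi> w)) \<le> (1/2) * dist z w" for z w
  proof (rule dist_bound)
    fix t
    have "((\<lambda>t. J z t - J w t) has_vector_derivative v (curve z s) - v (curve w s)) (at s)" for s
      by (intro has_vector_derivative_diff J)
    from primitive_exp_bound[OF this _ curve_diff K]
    have "exp (- (K * \<bar>t\<bar>)) * norm (J z t - J w t) \<le> L * dist z w / K"
      by (simp add: J0)
    then show "dist (apply_bcontfun (Bcontfun (\<Psi> z)) t) (apply_bcontfun (Bcontfun (\<Psi> w)) t) \<le> (1/2) * dist z w"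
      using \<open>L > 0\<close>
      by (simp add: Bcontfun_inverse \<Psi> dist_norm \<Psi>_def K_def scaleR_diff_right[symmetric])
  qed
  then have "\<exists>!z. Bcontfun (\<Psi> z) = z"
    by (intro banach_fix_type[of "1/2"]) auto
  then obtain z where z: "Bcontfun (\<Psi> z) = z"
    by blast
  have "curve z = (\<lambda>t. x + J z t)"
  proof
    fix t
    have "apply_bcontfun z t = \<Psi> z t"
      using Bcontfun_inverse[OF \<Psi>, of z] z by simp
    then show "curve z t = x + J z t"
      by (simp add: curve_def \<Psi>_def exp_minus)
  qed
  moreover have "((\<lambda>t. x + J z t) has_vector_derivative v (curve z t)) (at t)" for t
    using J[of z t] by (auto intro!: derivative_eq_intros)
  ultimately show ?thesis
    by (intro exI[of _ "curve z"]) (auto simp: J0)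
qed

lemma lipschitz_field_has_flow:
  fixes v :: "real^'n \<Rightarrow> real^'n"
  assumes "L > 0" and "\<And>p q. norm (v p - v q) \<le> L * norm (p - q)"
  shows "\<exists>X. is_flow UNIV (\<lambda>t. v) X"
proof -
  obtain Y where Y0: "\<And>x. Y x 0 = x" and Y: "\<And>x t. (Y x has_vector_derivative v (Y x t)) (at t)"
    using lipschitz_ode_global_solution[OF assms] by metis
  have "((\<lambda>s. Y x (s - t0)) has_vector_derivative v (Y x (t - t0))) (at t)" for x t t0
  proof -
    have "((Y x \<circ> (\<lambda>s. s - t0)) has_vector_derivative 1 *\<^sub>R v (Y x (t - t0))) (at t)"
      by (intro vector_diff_chain_at Y) (auto intro!: derivative_eq_intros)
    then show ?thesis
      by (simp add: comp_def)
  qed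
  then have "is_flow UNIV (\<lambda>t. v) (\<lambda>t t0 x. Y x (t - t0))"
    by (simp add: is_flow_def Y0)
  then show ?thesis
    by blast
qed

section \<open>Densities supported in the rest region\<close>

text \<open>Characteristics through \<open>U\<close> are constant, and by uniqueness no characteristic enters \<open>U\<close> from
outside. On \<open>U\<close> the Lagrangian formula therefore reads \<open>u x = u x\<close>, as the divergence vanishes
along the constant characteristic; off \<open>U\<close> both sides are zero almost everywhere. The same
statement verifies that the constant density is a solution and that a solution is constant.\<close>

lemma transport_of_resting_density:
  fixes v :: "real \<Rightarrow> real^'n \<Rightarrow> real^'n"
  assumes flow: "is_flow UNIV v X"
    and lip: "\<And>s p q. \<bar>s\<bar> \<le> T \<Longrightarrow> norm (v s p - v s q) \<le> L * norm (p - q)"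
    and "open U" and rest: "\<And>s p. \<bar>s\<bar> \<le> T \<Longrightarrow> p \<in> U \<Longrightarrow> v s p = 0"
    and u: "AE x in lebesgue. u x \<noteq> 0 \<longrightarrow> x \<in> U"
    and t: "\<bar>t\<bar> \<le> T"
  shows "AE x in lebesgue.
    u x = u (X 0 t x) * exp (- (LBINT \<tau>=ereal 0..ereal t. divergence (v \<tau>) (X \<tau> t x)))"
proof -
  have X: "X t t z = z" "((\<lambda>s. X s t z) has_vector_derivative v s (X s t z)) (at s)" for s z
    using flow unfolding is_flow_def by auto
  have seg: "\<bar>s\<bar> \<le> T" if "s \<in> closed_segment 0 t" for s
    using that t by (auto simp: closed_segment_eq_real_ivl split: if_splits)
  have const: "X b t x = X a t x" if "X a t x \<in> U" "closed_segment a b \<subseteq> closed_segment 0 t" for a b x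
  proof (rule stays_at_rest[where L=L and v=v])
    fix s q assume "s \<in> closed_segment a b"
    then show "norm (v s q) \<le> L * norm (q - X a t x)"
      using lip[of s q "X a t x"] rest[of s "X a t x"] seg that by auto
  qed (rule X)
  have "AE x in lebesgue. u (X 0 t x) \<noteq> 0 \<longrightarrow> X 0 t x \<in> U"
    by (rule AE_flow_preimage[where P="\<lambda>y. u y \<noteq> 0 \<longrightarrow> y \<in> U", OF flow _ t u]) (rule lip)
  with u show ?thesis
  proof eventually_elim
    case (elim x)
    show ?case
    proof (cases "x \<in> U")
      case True
      have stay: "X s t x = x" if "s \<in> closed_segment 0 t" for s
        using const[of t x s] True that by (simp add: X subset_closed_segment)
      have "(LBINT \<tau>=ereal 0..ereal t. divergence (v \<tau>) (X \<tau> t x)) = (LBINT \<tau>=ereal 0..ereal t. 0)"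
      proof (rule interval_integral_cong)
        fix s assume "s \<in> einterval (min (ereal 0) (ereal t)) (max (ereal 0) (ereal t))"
        then have s: "s \<in> closed_segment 0 t"
          by (auto simp: einterval_def closed_segment_eq_real_ivl min_def max_def split: if_splits)
        have "dpart (axis j 1) (v s) x = 0" for j
          using \<open>open U\<close> True rest seg[OF s] by (intro dpart_eq_0_if_locally_zero[of U]) auto
        then show "divergence (v s) (X s t x) = 0"
          by (simp add: stay[OF s] divergence_def)
      qed
      then show ?thesis
        by (simp add: stay)
    next
      case False
      have "X 0 t x \<notin> U"
      proof
        assume "X 0 t x \<in> U"
        then show False
          using const[of 0 x t] False by (simp add: X)
      qed
      then show ?thesis
        using False elim by auto
    qed
  qed
qed

lemma curve_displacement:
  fixes \<gamma> :: "real \<Rightarrow> 'a::real_normed_vector"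
  assumes "\<And>s. s \<in> closed_segment a b \<Longrightarrow> (\<gamma> has_vector_derivative \<gamma>' s) (at s)"
    and "\<And>s. s \<in> closed_segment a b \<Longrightarrow> norm (\<gamma>' s) \<le> M"
  shows "norm (\<gamma> b - \<gamma> a) \<le> M * \<bar>b - a\<bar>"
proof -
  have "norm (\<gamma> b - \<gamma> a) \<le> M * norm (b - a)"
  proof (rule differentiable_bound[of "closed_segment a b" \<gamma> "\<lambda>s h. h *\<^sub>R \<gamma>' s"])
    fix s assume "s \<in> closed_segment a b"
    then show "onorm (\<lambda>h. h *\<^sub>R \<gamma>' s) \<le> M"
      using assms(2)[of s] by (intro onorm_le) (auto simp: mult.commute[of M] intro!: mult_left_mono)
  qed (use assms(1) in \<open>auto simp: has_vector_derivative_def intro: has_derivative_at_withinI\<close>)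
  then show ?thesis
    by simp
qed

text \<open>While \<open>\<bar>s\<bar> \<le> a\<close> the points of \<open>S\<close> do not move; in the remaining time, at most \<open>\<epsilon>\<close>, a
characteristic covers a distance of at most \<open>M \<epsilon>\<close>. So an initial density carried by \<open>S\<close> is
found in the \<open>M \<epsilon>\<close>-neighbourhood of \<open>S\<close>.\<close>

lemma support_spreads_slowly:
  fixes v :: "real \<Rightarrow> real^'n \<Rightarrow> real^'n"
  assumes flow: "is_flow UNIV v X"
    and lip: "\<And>s p q. \<bar>s\<bar> \<le> T \<Longrightarrow> norm (v s p - v s q) \<le> L * norm (p - q)"
    and speed: "\<And>s p. \<bar>s\<bar> \<le> T \<Longrightarrow> norm (v s p) \<le> M"
    and rest: "\<And>s p. \<bar>s\<bar> \<le> T \<Longrightarrow> \<bar>s\<bar> \<le> a \<Longrightarrow> p \<in> S \<Longrightarrow> v s p = 0"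
    and u: "AE x in lebesgue. u x \<noteq> 0 \<longrightarrow> x \<in> S"
    and t: "\<bar>t\<bar> \<le> T" "\<bar>t\<bar> \<le> a + \<epsilon>" and "0 \<le> a" "0 \<le> \<epsilon>"
  shows "AE x in lebesgue. u (X 0 t x) \<noteq> 0 \<longrightarrow> (\<exists>p\<in>S. dist p x \<le> M * \<epsilon>)"
proof -
  have "AE x in lebesgue. u (X 0 t x) \<noteq> 0 \<longrightarrow> X 0 t x \<in> S"
    by (rule AE_flow_preimage[where P="\<lambda>y. u y \<noteq> 0 \<longrightarrow> y \<in> S", OF flow _ t(1) u]) (rule lip)
  then show ?thesis
  proof eventually_elim
    case (elim x)
    have X: "X t t z = z" "((\<lambda>s. X s t z) has_vector_derivative v s (X s t z)) (at s)" for s z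
      using flow unfolding is_flow_def by auto
    have seg: "\<bar>s\<bar> \<le> T" if "s \<in> closed_segment 0 t" for s
      using that t by (auto simp: closed_segment_eq_real_ivl split: if_splits)
    \<comment> \<open>The last time between \<open>0\<close> and \<open>t\<close> up to which the points of \<open>S\<close> are known to rest.\<close>
  define b where "b = max (- a) (min a t)"
    have b: "closed_segment 0 b \<subseteq> closed_segment 0 t" "closed_segment b t \<subseteq> closed_segment 0 t"
      "\<And>s. s \<in> closed_segment 0 b \<Longrightarrow> \<bar>s\<bar> \<le> a" "\<bar>t - b\<bar> \<le> \<epsilon>"
      using \<open>0 \<le> a\<close> \<open>0 \<le> \<epsilon>\<close> t(2)
      by (auto simp: b_def closed_segment_eq_real_ivl split: if_splits)
    show ?case
    proof
      assume "u (X 0 t x) \<noteq> 0"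
      then have S: "X 0 t x \<in> S"
        using elim by simp
      have "X b t x = X 0 t x"
      proof (rule stays_at_rest[where L=L and v=v])
        fix s q assume "s \<in> closed_segment 0 b"
        then show "norm (v s q) \<le> L * norm (q - X 0 t x)"
          using lip[of s q "X 0 t x"] rest[of s "X 0 t x"] seg b S by auto
      qed (rule X)
      moreover have "norm (X t t x - X b t x) \<le> M * \<bar>t - b\<bar>"
        by (rule curve_displacement[where \<gamma>'="\<lambda>s. v s (X s t x)"]) (use b seg X speed in auto)
      moreover have "M * \<bar>t - b\<bar> \<le> M * \<epsilon>"
        using b(4) order_trans[OF norm_ge_zero speed[OF t(1)]] by (intro mult_left_mono)
      ultimately show "\<exists>p\<in>S. dist p x \<le> M * \<epsilon>"
        using S by (intro bexI[of _ "X 0 t x"]) (auto simp: X dist_norm norm_minus_commute)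
    qed
  qed
qed

section \<open>Existence and uniqueness of the stationary solution\<close>

lemma C0_L1_norm_bounded:
  assumes "C0_L1 UNIV \<rho>"
  obtains R where "R > 0" "\<And>s. \<bar>s\<bar> \<le> T \<Longrightarrow> (LINT x|lebesgue. norm (\<rho> s x)) \<le> R"
proof -
  let ?N = "\<lambda>s. LINT x|lebesgue. norm (\<rho> s x)"
  have int: "integrable lebesgue (\<rho> s)" for s
    using assms by (simp add: C0_L1_def)
  have "(?N \<longlongrightarrow> ?N t) (at t)" for t
  proof (rule LIM_zero_cancel, rule Lim_null_comparison)
    show "((\<lambda>s. LINT x|lebesgue. norm (\<rho> s x - \<rho> t x)) \<longlongrightarrow> 0) (at t)"
      using assms by (simp add: C0_L1_def)
    have "norm (?N s - ?N t) \<le> (LINT x|lebesgue. norm (\<rho> s x - \<rho> t x))" for s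
    proof -
      have "norm (LINT x|lebesgue. norm (\<rho> s x) - norm (\<rho> t x)) \<le> (LINT x|lebesgue. norm (\<rho> s x - \<rho> t x))"
        by (rule Bochner_Integration.integral_norm_bound_integral) (auto intro!: int norm_triangle_ineq3)
      then show ?thesis
        by (simp add: int)
    qed
    then show "\<forall>\<^sub>F s in at t. norm (?N s - ?N t) \<le> (LINT x|lebesgue. norm (\<rho> s x - \<rho> t x))"
      by simp
  qed
  then have "continuous_on {- T..T} ?N"
    by (simp add: continuous_at_imp_continuous_on isCont_def)
  then have "bounded (?N ` {- T..T})"
    by (intro compact_imp_bounded compact_continuous_image) auto
  then obtain R where "\<And>s. \<bar>s\<bar> \<le> T \<Longrightarrow> \<bar>?N s\<bar> \<le> R"
    unfolding bounded_iff by (metis abs_le_iff atLeastAtMost_iff image_eqI minus_le_iff real_norm_def)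
  then have "\<And>s. \<bar>s\<bar> \<le> T \<Longrightarrow> ?N s \<le> max R 1"
    using abs_le_iff le_max_iff_disj by blast
  then show ?thesis
    using that[of "max R 1"] by auto
qed

lemma constant_is_solution:
  fixes V :: "real^'m^'n \<Rightarrow> real^'m^'n" and \<eta> :: "real^'n \<Rightarrow> real" and \<rho>\<^sub>o :: "real^'n \<Rightarrow> real^'m"
  assumes V: "V_assm V" and \<eta>: "eta_assm \<eta>" "spt (grad \<eta>) \<subseteq> ball 0 l - ball 0 r"
    and \<rho>\<^sub>o: "integrable lebesgue \<rho>\<^sub>o" "AE x in lebesgue. \<rho>\<^sub>o x \<noteq> 0 \<longrightarrow> x \<in> U"
    and U: "open U" "\<And>p q. p \<in> U \<Longrightarrow> q \<in> U \<Longrightarrow> norm (p - q) < r \<or> l \<le> norm (p - q)"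
  shows "nonlocal_solution V \<eta> UNIV \<rho>\<^sub>o (\<lambda>t. \<rho>\<^sub>o)"
proof -
  have "lagrangian_solution UNIV (velocity V \<eta> (\<lambda>t. \<rho>\<^sub>o) i) (\<lambda>x. \<rho>\<^sub>o x $ i) (\<lambda>t x. \<rho>\<^sub>o x $ i)" for i
  proof -
    define w where "w = velocity V \<eta> (\<lambda>t. \<rho>\<^sub>o) i 0"
    have v: "velocity V \<eta> (\<lambda>t. \<rho>\<^sub>o) i = (\<lambda>t. w)"
      by (intro ext) (simp add: w_def velocity_def)
    obtain L where L: "L > 0" "\<And>p q. norm (w p - w q) \<le> L * norm (p - q)"
    proof -
      obtain C where C: "C > 0" "\<And>\<rho> i t p q. integrable lebesgue (\<rho> t) \<Longrightarrow>
         norm (velocity V \<eta> \<rho> i t p - velocity V \<eta> \<rho> i t q)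
         \<le> C * (LINT \<xi>|lebesgue. norm (\<rho> t \<xi>)) * norm (p - q)"
        by (rule velocity_estimates[OF V \<eta>]) blast
      let ?L = "C * (LINT \<xi>|lebesgue. norm (\<rho>\<^sub>o \<xi>))"
      have "norm (w p - w q) \<le> (?L + 1) * norm (p - q)" for p q
        using C(2)[of "\<lambda>t. \<rho>\<^sub>o" 0 i p q, OF \<rho>\<^sub>o(1)] norm_ge_zero[of "p - q"]
        unfolding distrib_right mult_1 w_def by linarith
      moreover have "?L + 1 > 0"
        using \<open>C > 0\<close> by (intro add_nonneg_pos mult_nonneg_nonneg) auto
      ultimately show ?thesis
        using that by blast
    qed
    obtain X where X: "is_flow UNIV (\<lambda>t. w) X"
      using lipschitz_field_has_flow[OF L] by blast
    have w0: "w p = 0" if "p \<in> U" for p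
      unfolding w_def using grad_conv_vanishes[OF \<eta> \<rho>\<^sub>o U(2) that] by (intro velocity_vanishes V)
    have "AE x in lebesgue. \<rho>\<^sub>o x $ i \<noteq> 0 \<longrightarrow> x \<in> U"
      using \<rho>\<^sub>o(2) by eventually_elim auto
    then have "AE x in lebesgue. \<rho>\<^sub>o x $ i =
        \<rho>\<^sub>o (X 0 t x) $ i * exp (- (LBINT \<tau>=ereal 0..ereal t. divergence w (X \<tau> t x)))" for t
      using transport_of_resting_density[OF X, of "\<bar>t\<bar>" L U "\<lambda>x. \<rho>\<^sub>o x $ i" t] L(2) U(1) w0
      by auto
    then show ?thesis
      unfolding v lagrangian_solution_def using X by blast
  qed
  moreover have "\<exists>s t :: real. s < t"
    using zero_less_one by blast
  ultimately show ?thesis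
    using \<rho>\<^sub>o(1) by (simp add: nonlocal_solution_def C0_L1_def)
qed

text \<open>The support of \<open>\<rho>\<close> has to be kept in \<open>U\<close> to know that the velocity vanishes on \<open>U\<close>, and
conversely. The circle is broken by stepping in time. The speed is at most \<open>M\<close> on \<open>[-T, T]\<close>
and \<open>S\<close> has distance at least \<open>\<delta>\<close> from the complement of \<open>U\<close>. If \<open>U\<close> is at rest up to time
\<open>k \<epsilon>\<close> with \<open>\<epsilon> = \<delta> / M\<close>, then up to time \<open>(k + 1) \<epsilon>\<close> the density cannot leave \<open>U\<close>, so that
\<open>U\<close> is still at rest by then. The step \<open>\<epsilon>\<close> does not depend on \<open>k\<close>.\<close>

lemma solution_is_constant:
  fixes V :: "real^'m^'n \<Rightarrow> real^'m^'n" and \<eta> :: "real^'n \<Rightarrow> real" and \<rho>\<^sub>o :: "real^'n \<Rightarrow> real^'m"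
  assumes V: "V_assm V" and \<eta>: "eta_assm \<eta>" "spt (grad \<eta>) \<subseteq> ball 0 l - ball 0 r"
    and S: "AE x in lebesgue. \<rho>\<^sub>o x \<noteq> 0 \<longrightarrow> x \<in> S" "compact S" "S \<subseteq> U"
    and U: "open U" "\<And>p q. p \<in> U \<Longrightarrow> q \<in> U \<Longrightarrow> norm (p - q) < r \<or> l \<le> norm (p - q)"
    and sol: "nonlocal_solution V \<eta> UNIV \<rho>\<^sub>o \<rho>"
  shows "AE x in lebesgue. \<rho> t x = \<rho>\<^sub>o x"
proof -
  define T where "T = \<bar>t\<bar>"
  have C0: "C0_L1 UNIV \<rho>"
    using sol by (simp add: nonlocal_solution_def)
  then have int: "integrable lebesgue (\<rho> s)" for s
    by (simp add: C0_L1_def)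
  have "\<forall>i. \<exists>X. is_flow UNIV (velocity V \<eta> \<rho> i) X \<and> (\<forall>s. AE x in lebesgue. \<rho> s x $ i =
      \<rho>\<^sub>o (X 0 s x) $ i * exp (- (LBINT \<tau>=ereal 0..ereal s. divergence (velocity V \<eta> \<rho> i \<tau>) (X \<tau> s x))))"
    using sol by (simp add: nonlocal_solution_def lagrangian_solution_def)
  from choice[OF this] obtain X where X: "\<And>i. is_flow UNIV (velocity V \<eta> \<rho> i) (X i)"
    and \<rho>: "\<And>i s. AE x in lebesgue. \<rho> s x $ i = \<rho>\<^sub>o (X i 0 s x) $ i *
      exp (- (LBINT \<tau>=ereal 0..ereal s. divergence (velocity V \<eta> \<rho> i \<tau>) (X i \<tau> s x)))"
    by blast
  obtain C where C: "C > 0"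
    "\<And>\<rho> i t p. integrable lebesgue (\<rho> t) \<Longrightarrow>
       norm (velocity V \<eta> \<rho> i t p) \<le> C * (LINT \<xi>|lebesgue. norm (\<rho> t \<xi>))"
    "\<And>\<rho> i t p q. integrable lebesgue (\<rho> t) \<Longrightarrow>
       norm (velocity V \<eta> \<rho> i t p - velocity V \<eta> \<rho> i t q)
         \<le> C * (LINT \<xi>|lebesgue. norm (\<rho> t \<xi>)) * norm (p - q)"
    by (rule velocity_estimates[OF V \<eta>]) blast
  obtain R where R: "R > 0" "\<And>s. \<bar>s\<bar> \<le> T \<Longrightarrow> (LINT x|lebesgue. norm (\<rho> s x)) \<le> R"
    by (rule C0_L1_norm_bounded[OF C0]) blast
  define M where "M = C * R"
  have "M > 0"
    using C(1) R(1) by (simp add: M_def)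
  have CM: "C * (LINT \<xi>|lebesgue. norm (\<rho> s \<xi>)) \<le> M" if "\<bar>s\<bar> \<le> T" for s
    unfolding M_def using C(1) R(2)[OF that] by (intro mult_left_mono) auto
  have speed: "norm (velocity V \<eta> \<rho> i s p) \<le> M" if "\<bar>s\<bar> \<le> T" for i s p
    by (rule order_trans[OF C(2)[of \<rho> s i p, OF int] CM[OF that]])
  have lip: "norm (velocity V \<eta> \<rho> i s p - velocity V \<eta> \<rho> i s q) \<le> M * norm (p - q)"
    if "\<bar>s\<bar> \<le> T" for i s p q
    by (rule order_trans[OF C(3)[of \<rho> s i p q, OF int] mult_right_mono[OF CM[OF that] norm_ge_zero]])
  have S_comp: "AE x in lebesgue. \<rho>\<^sub>o x $ i \<noteq> 0 \<longrightarrow> x \<in> S" for i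
    using S(1) by eventually_elim auto
  have still: "grad_conv (\<rho> s) \<eta> p = 0"
    if "\<And>i. AE x in lebesgue. \<rho>\<^sub>o (X i 0 s x) $ i \<noteq> 0 \<longrightarrow> x \<in> U" "p \<in> U" for s p
  proof (rule grad_conv_vanishes[OF \<eta> int _ U(2) \<open>p \<in> U\<close>])
    have "AE x in lebesgue. \<rho> s x $ i \<noteq> 0 \<longrightarrow> x \<in> U" for i
      using \<rho>[of s i] that(1)[of i] by eventually_elim auto
    then have "AE x in lebesgue. \<forall>i. \<rho> s x $ i \<noteq> 0 \<longrightarrow> x \<in> U"
      by (rule AE_all_components)
    then show "AE x in lebesgue. \<rho> s x \<noteq> 0 \<longrightarrow> x \<in> U"
      by eventually_elim (auto simp: vec_eq_iff)
  qed
  obtain \<delta> where \<delta>: "\<delta> > 0" "(\<Union>x\<in>S. cball x \<delta>) \<subseteq> U"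
    by (rule compact_subset_open_imp_cball_epsilon_subset[OF S(2) U(1) S(3)])
  define \<epsilon> where "\<epsilon> = \<delta> / M"
  have \<epsilon>: "\<epsilon> > 0" "M * \<epsilon> = \<delta>"
    using \<delta>(1) \<open>M > 0\<close> by (auto simp: \<epsilon>_def)
  have rest: "\<forall>s. \<bar>s\<bar> \<le> T \<longrightarrow> \<bar>s\<bar> \<le> real k * \<epsilon> \<longrightarrow> (\<forall>p\<in>U. grad_conv (\<rho> s) \<eta> p = 0)" for k
  proof (induction k)
    case 0
    have "AE x in lebesgue. \<rho>\<^sub>o (X i 0 0 x) $ i \<noteq> 0 \<longrightarrow> x \<in> U" for i
    proof -
      have "X i 0 0 x = x" for x
        using X[of i] by (simp add: is_flow_def)
      then show ?thesis
        using S_comp[of i] S(3) by (auto elim: eventually_mono)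
    qed
    then show ?case
      using still[of 0] by simp
  next
    case (Suc k)
    show ?case
    proof (intro allI impI ballI)
      fix s p assume s: "\<bar>s\<bar> \<le> T" "\<bar>s\<bar> \<le> real (Suc k) * \<epsilon>" and "p \<in> U"
      show "grad_conv (\<rho> s) \<eta> p = 0"
      proof (rule still[OF _ \<open>p \<in> U\<close>])
        fix i
        have "AE x in lebesgue. \<rho>\<^sub>o (X i 0 s x) $ i \<noteq> 0 \<longrightarrow> (\<exists>p\<in>S. dist p x \<le> M * \<epsilon>)"
        proof (rule support_spreads_slowly[where T=T and a="real k * \<epsilon>"])
          fix \<tau> p assume "\<bar>\<tau>\<bar> \<le> T" "\<bar>\<tau>\<bar> \<le> real k * \<epsilon>" "p \<in> S"
          then show "velocity V \<eta> \<rho> i \<tau> p = 0"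
            using Suc.IH S(3) by (intro velocity_vanishes V) auto
        qed (use X lip speed S_comp s \<epsilon> in \<open>auto simp: algebra_simps\<close>)
        then show "AE x in lebesgue. \<rho>\<^sub>o (X i 0 s x) $ i \<noteq> 0 \<longrightarrow> x \<in> U"
          by eventually_elim (auto simp: \<epsilon>(2) intro!: subsetD[OF \<delta>(2)])
      qed
    qed
  qed
  obtain k where k: "T \<le> real k * \<epsilon>"
    using reals_Archimedean3[OF \<epsilon>(1)] by (meson less_imp_le)
  have rest: "velocity V \<eta> \<rho> i s p = 0" if "\<bar>s\<bar> \<le> T" "p \<in> U" for i s p
    using rest[of k] that k by (intro velocity_vanishes V) auto
  have "AE x in lebesgue. \<rho> t x $ i = \<rho>\<^sub>o x $ i" for i
  proof -
    have "AE x in lebesgue. \<rho>\<^sub>o x $ i \<noteq> 0 \<longrightarrow> x \<in> U"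
      using S_comp[of i] by eventually_elim (use S(3) in auto)
    then have "AE x in lebesgue. \<rho>\<^sub>o x $ i = \<rho>\<^sub>o (X i 0 t x) $ i *
        exp (- (LBINT \<tau>=ereal 0..ereal t. divergence (velocity V \<eta> \<rho> i \<tau>) (X i \<tau> t x)))"
      by (intro transport_of_resting_density[where T=T and L=M and U=U] X U(1))
        (auto simp: rest T_def intro: lip[unfolded T_def])
    with \<rho>[of t i] show ?thesis
      by eventually_elim simp
  qed
  then have "AE x in lebesgue. \<forall>i. \<rho> t x $ i = \<rho>\<^sub>o x $ i"
    by (rule AE_all_components)
  then show ?thesis
    by eventually_elim (simp add: vec_eq_iff)
qed

theorem proposition2p7:
  fixes V :: "real^'m^'n \<Rightarrow> real^'m^'n"
    and \<eta> :: "real^'n \<Rightarrow> real"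
    and \<rho>\<^sub>o :: "real^'n \<Rightarrow> real^'m"
    and r l :: real and k :: nat and x :: "nat \<Rightarrow> real^'n"
  assumes "V_assm V" and "eta_assm \<eta>"
    and "integrable lebesgue \<rho>\<^sub>o" and "L_inf \<rho>\<^sub>o" and "\<And>i. BV (\<lambda>y. \<rho>\<^sub>o y $ i)"
    and "l > r" and "r > 0"
    and "spt (grad \<eta>) \<subseteq> ball 0 l - ball 0 r"
    and "spt \<rho>\<^sub>o \<subseteq> (\<Union>h\<in>{1..k}. ball (x h) (r / 2))"
    and "\<And>h j. h \<in> {1..k} \<Longrightarrow> j \<in> {1..k} \<Longrightarrow> h \<noteq> j \<Longrightarrow> norm (x h - x j) > r + l"
  shows "nonlocal_solution V \<eta> UNIV \<rho>\<^sub>o (\<lambda>t. sol_op V \<eta> t \<rho>\<^sub>o)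
    \<and> (\<forall>\<rho>. nonlocal_solution V \<eta> UNIV \<rho>\<^sub>o \<rho> \<longrightarrow>
           (\<forall>t. AE y in lebesgue. \<rho> t y = sol_op V \<eta> t \<rho>\<^sub>o y))
    \<and> (\<forall>t\<ge>0. AE y in lebesgue. sol_op V \<eta> t \<rho>\<^sub>o y = \<rho>\<^sub>o y)"
proof -
  define U where "U = (\<Union>h\<in>{1..k}. ball (x h) (r / 2))"
  have U: "open U" "bounded U" "spt \<rho>\<^sub>o \<subseteq> U"
    using assms(9) by (auto simp: U_def)
  have compact: "compact (spt \<rho>\<^sub>o)"
    using U by (simp add: compact_eq_bounded_closed closed_spt bounded_subset)
  note supp = AE_nonzero_on_support[of \<rho>\<^sub>o]
  then have supp': "AE x in lebesgue. \<rho>\<^sub>o x \<noteq> 0 \<longrightarrow> x \<in> U"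
    by eventually_elim (use U(3) in auto)
  have gap: "norm (p - q) < r \<or> l \<le> norm (p - q)" if pq: "p \<in> U" "q \<in> U" for p q
  proof -
    obtain h j where h: "h \<in> {1..k}" "norm (x h - p) < r / 2" and j: "j \<in> {1..k}" "norm (x j - q) < r / 2"
      using pq unfolding U_def UN_iff mem_ball dist_norm by blast
    show ?thesis
    proof (cases "h = j")
      case True
      have "norm (p - q) \<le> norm (x h - p) + norm (x h - q)"
        using norm_triangle_ineq4[of "x h - q" "x h - p"] by simp
      then show ?thesis
        using h j True by simp
    next
      case False
      have "norm (x h - x j) \<le> norm (x h - p) + norm (p - q) + norm (x j - q)"
        using norm_triangle_ineq4[of "(x h - p) + (p - q)" "x j - q"]
          norm_triangle_ineq[of "x h - p" "p - q"] by simp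
      then show ?thesis
        using h j assms(10)[OF h(1) j(1) False] by simp
    qed
  qed
  have "nonlocal_solution V \<eta> UNIV \<rho>\<^sub>o (\<lambda>t. \<rho>\<^sub>o)"
    by (rule constant_is_solution[OF assms(1,2,8,3) supp' U(1) gap])
  \<comment> \<open>The existence of some solution is what makes the choice in \<open>sol_op\<close> a solution.\<close>
  then have "nonlocal_solution V \<eta> UNIV \<rho>\<^sub>o (SOME \<rho>. nonlocal_solution V \<eta> UNIV \<rho>\<^sub>o \<rho>)"
    by (rule someI[where P="nonlocal_solution V \<eta> UNIV \<rho>\<^sub>o"])
  then have sol: "nonlocal_solution V \<eta> UNIV \<rho>\<^sub>o (\<lambda>t. sol_op V \<eta> t \<rho>\<^sub>o)"
    by (simp add: sol_op_def)
  have const: "AE y in lebesgue. \<rho> t y = \<rho>\<^sub>o y" if "nonlocal_solution V \<eta> UNIV \<rho>\<^sub>o \<rho>" for \<rho> t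
    by (rule solution_is_constant[OF assms(1,2,8) supp compact U(3,1) gap that])
  have "AE y in lebesgue. \<rho> t y = sol_op V \<eta> t \<rho>\<^sub>o y" if "nonlocal_solution V \<eta> UNIV \<rho>\<^sub>o \<rho>" for \<rho> t
    using const[OF that, of t] const[OF sol, of t] by eventually_elim simp
  then show ?thesis
    using sol const[OF sol] by blast
qed

end
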